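(* Let $X$ be a compactum such that the idempotent barycenter map $\beta_{IX}:I(IX)\to IX$ is $0$-soft. Then $X$ is metrizable.
   Context: A compactum is a compact Hausdorff space; all maps are continuous. For a compactum $X$, $C(X)$ is the Banach space of real-valued continuous functions on $X$ with the sup-norm, and $c_X$ is the constant function with value $c\in\mathbb R$. Idempotent measures: write $\oplus$ for $\max$ and $\odot$ for $+$ (for functions, $\lambda\odot\varphi=\lambda_X+\varphi$ for $\lambda\in\mathbb R$, and $\psi\oplus\varphi=\max\{\psi,\varphi\}$ pointwise). An idempotent measure on $X$ is a functional $\mu:C(X)\to\mathbb R$ such that (1) $\mu(1_X)=1$; (2) $\mu(\lambda\odot\varphi)=\lambda\odot\mu(\varphi)$ for all $\lambda\in\mathbb R$, $\varphi\in C(X)$; (3) $\mu(\psi\oplus\varphi)=\mu(\psi)\oplus\mu(\varphi)$ for all $\psi,\varphi\in C(X)$. $IX$ is the set of all idempotent measures on $X$ with the subspace topology from the product $\mathbb R^{C(X)}$; it is a compactum, so $I(IX)$ is defined. The map $\beta_{IX}:I(IX)\to IX$ is given by $\beta_{IX}(\mathcal M)(\varphi)=\mathcal M(\tilde\varphi)$ for $\mathcal M\in I(IX)$, $\varphi\in C(X)$, where $\tilde\varphi\in C(IX)$ is $\tilde\varphi(\nu)=\nu(\varphi)$. A map $f:X\to Y$ is $0$-soft if for any $0$-dimensional paracompact space $Z$, any closed subspace $A$ of $Z$ and maps $\Phi:A\to X$, $\Psi:Z\to Y$ with $\Psi|A=f\circ\Phi$, there exists a map $G:Z\to X$ such that $G|A=\Phi$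 and $\Psi=f\circ G$. *)

theory Defs
  imports "HOL-Analysis.Analysis"
begin

section \<open>Idempotent measures\<close>

text \<open>A functional on \<open>C(X)\<close> is meaningful only when \<open>C(X)\<close> is a set of functions on the points
  of \<open>X\<close>; as usual in HOL, functions on a carrier are represented by their \<^const>\<open>extensional\<close>
  representatives. Boundedness in \<^const>\<open>cfunspace\<close> is automatic for compact \<open>X\<close>, see
  \<open>mem_CX_iff\<close> below.\<close>

definition CX :: "'a topology \<Rightarrow> ('a \<Rightarrow> real) set" where
  "CX X = mspace (cfunspace X euclidean_metric)"

definition cst :: "'a topology \<Rightarrow> real \<Rightarrow> 'a \<Rightarrow> real" where
  "cst X c = (\<lambda>x\<in>topspace X. c)"

definition odot :: "'a topology \<Rightarrow> real \<Rightarrow> ('a \<Rightarrow> real) \<Rightarrow> 'a \<Rightarrow> real" where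
  "odot X l \<phi> = (\<lambda>x\<in>topspace X. l + \<phi> x)"

definition oplus :: "'a topology \<Rightarrow> ('a \<Rightarrow> real) \<Rightarrow> ('a \<Rightarrow> real) \<Rightarrow> 'a \<Rightarrow> real" where
  "oplus X \<psi> \<phi> = (\<lambda>x\<in>topspace X. max (\<psi> x) (\<phi> x))"

definition idempotent_measure :: "'a topology \<Rightarrow> (('a \<Rightarrow> real) \<Rightarrow> real) \<Rightarrow> bool" where
  "idempotent_measure X \<mu> \<longleftrightarrow>
     \<mu> \<in> extensional (CX X) \<and>
     \<mu> (cst X 1) = 1 \<and>
     (\<forall>l. \<forall>\<phi>\<in>CX X. \<mu> (odot X l \<phi>) = l + \<mu> \<phi>) \<and>
     (\<forall>\<psi>\<in>CX X. \<forall>\<phi>\<in>CX X. \<mu> (oplus X \<psi> \<phi>) = max (\<mu> \<psi>) (\<mu> \<phi>))"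

definition IX :: "'a topology \<Rightarrow> (('a \<Rightarrow> real) \<Rightarrow> real) topology" where
  "IX X = subtopology (product_topology (\<lambda>_. euclideanreal) (CX X)) {\<mu>. idempotent_measure X \<mu>}"

definition tilde :: "'a topology \<Rightarrow> ('a \<Rightarrow> real) \<Rightarrow> (('a \<Rightarrow> real) \<Rightarrow> real) \<Rightarrow> real" where
  "tilde X \<phi> = (\<lambda>\<nu>\<in>topspace (IX X). \<nu> \<phi>)"

definition idem_barycenter ::
    "'a topology \<Rightarrow> (((('a \<Rightarrow> real) \<Rightarrow> real) \<Rightarrow> real) \<Rightarrow> real) \<Rightarrow> ('a \<Rightarrow> real) \<Rightarrow> real" where
  "idem_barycenter X M = (\<lambda>\<phi>\<in>CX X. M (tilde X \<phi>))"

lemma mem_CX_iff: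
  assumes "compact_space X"
  shows "\<phi> \<in> CX X \<longleftrightarrow> \<phi> \<in> extensional (topspace X) \<and> continuous_map X euclideanreal \<phi>"
proof -
  have "Met_TC.mbounded (\<phi> ` topspace X)" if "continuous_map X euclideanreal \<phi>"
    using image_compactin[OF assms[unfolded compact_space_def] that]
      compact_imp_bounded Met_TC.mbounded_def
    by (metis Met_TC.compactin_imp_mbounded mtopology_is_euclidean)
  then show ?thesis by (auto simp: CX_def)
qed

lemma topspace_IX: "topspace (IX X) = {\<mu>. idempotent_measure X \<mu>}"
  by (auto simp: IX_def idempotent_measure_def PiE_def)

lemma CX_closed:
  assumes "compact_space X"
  shows "cst X c \<in> CX X"
    and "\<phi> \<in> CX X \<Longrightarrow> odot X l \<phi> \<in> CX X"
    and "\<phi> \<in> CX X \<Longrightarrow> \<psi> \<in> CX X \<Longrightarrow> oplus X \<phi> \<psi> \<in> CX X"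
proof -
  have restr: "restrict g (topspace X) \<in> CX X" if "continuous_map X euclideanreal g" for g
  proof -
    have "continuous_map X euclideanreal (restrict g (topspace X))"
      using that by (rule continuous_map_eq) simp
    then show ?thesis unfolding mem_CX_iff[OF assms] by simp
  qed
  have cont: "continuous_map X euclideanreal g" if "g \<in> CX X" for g
    using that unfolding mem_CX_iff[OF assms] by (rule conjunct2)
  show "cst X c \<in> CX X"
    unfolding cst_def by (rule restr) simp
  show "odot X l \<phi> \<in> CX X" if "\<phi> \<in> CX X"
    unfolding odot_def by (rule restr, rule continuous_map_add) (simp, rule cont[OF that])
  show "oplus X \<phi> \<psi> \<in> CX X" if "\<phi> \<in> CX X" "\<psi> \<in> CX X"
    unfolding oplus_def by (rule restr, rule continuous_map_real_max) (rule cont that)+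
qed

lemma idempotent_measure_bound:
  assumes X: "compact_space X" and \<mu>: "idempotent_measure X \<mu>" and \<phi>: "\<phi> \<in> CX X"
    and B: "\<And>x. x \<in> topspace X \<Longrightarrow> \<bar>\<phi> x\<bar> \<le> B"
  shows "\<bar>\<mu> \<phi>\<bar> \<le> B"
proof -
  have ext: "\<phi> \<in> extensional (topspace X)" using \<phi> mem_CX_iff[OF X] by blast
  have c: "\<mu> (cst X c) = c" for c
  proof -
    have "cst X c = odot X (c - 1) (cst X 1)" by (auto simp: cst_def odot_def)
    then show ?thesis using \<mu> CX_closed(1)[OF X] unfolding idempotent_measure_def by simp
  qed
  have mono: "\<mu> \<psi> \<le> \<mu> \<theta>" if "oplus X \<psi> \<theta> = \<theta>" "\<psi> \<in> CX X" "\<theta> \<in> CX X" for \<psi> \<theta>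
    using \<mu> that unfolding idempotent_measure_def by (metis max.cobounded1)
  have "oplus X \<phi> (cst X B) = cst X B"
    using B by (auto simp: oplus_def cst_def fun_eq_iff max_def abs_le_iff intro: antisym)
  moreover have "oplus X (cst X (- B)) \<phi> = \<phi>"
    using B by (intro extensionalityI[OF _ ext]) (force simp: oplus_def cst_def max_def abs_le_iff)+
  ultimately show ?thesis
    using mono[OF _ \<phi> CX_closed(1)[OF X]] mono[OF _ CX_closed(1)[OF X] \<phi>] c
    by (metis abs_le_iff minus_le_iff)
qed

lemma IX_compactum:
  assumes X: "compact_space X"
  shows "compact_space (IX X)" "Hausdorff_space (IX X)"
proof -
  let ?P = "product_topology (\<lambda>_. euclideanreal) (CX X)"
  let ?S = "{\<mu>. idempotent_measure X \<mu>}"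
  show "Hausdorff_space (IX X)"
    unfolding IX_def by (intro Hausdorff_space_subtopology) (simp add: Hausdorff_space_product_topology)
  have proj: "continuous_map ?P euclideanreal (\<lambda>\<mu>. \<mu> \<phi>)" if "\<phi> \<in> CX X" for \<phi>
    using continuous_map_product_projection[OF that, of "\<lambda>_. euclideanreal"] .
  have eq: "closedin ?P {\<mu> \<in> topspace ?P. F \<mu> = G \<mu>}"
    if "continuous_map ?P euclideanreal F" "continuous_map ?P euclideanreal G" for F G
    using that by (intro closedin_continuous_maps_eq[of euclideanreal]) auto
  define \<K> where "\<K> = {{\<mu> \<in> topspace ?P. \<mu> (cst X 1) = 1}} \<union>
      {{\<mu> \<in> topspace ?P. \<mu> (odot X l \<phi>) = l + \<mu> \<phi>} | l \<phi>. \<phi> \<in> CX X} \<union>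
      {{\<mu> \<in> topspace ?P. \<mu> (oplus X \<psi> \<phi>) = max (\<mu> \<psi>) (\<mu> \<phi>)} | \<psi> \<phi>. \<psi> \<in> CX X \<and> \<phi> \<in> CX X}"
  have "closedin ?P k" if k: "k \<in> \<K>" for k
  proof -
    consider "k = {\<mu> \<in> topspace ?P. \<mu> (cst X 1) = 1}"
      | l \<phi> where "k = {\<mu> \<in> topspace ?P. \<mu> (odot X l \<phi>) = l + \<mu> \<phi>}" "\<phi> \<in> CX X"
      | \<psi> \<phi> where "k = {\<mu> \<in> topspace ?P. \<mu> (oplus X \<psi> \<phi>) = max (\<mu> \<psi>) (\<mu> \<phi>)}" "\<psi> \<in> CX X" "\<phi> \<in> CX X"
      using k unfolding \<K>_def by blast
    then show ?thesis
    proof cases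
      case 1
      then show ?thesis using eq[OF proj[OF CX_closed(1)[OF X]], of "\<lambda>_. 1" 1] by simp
    next
      case (2 l \<phi>)
      have "continuous_map ?P euclideanreal (\<lambda>\<mu>. l + \<mu> \<phi>)"
        using proj[OF 2(2)] by (intro continuous_map_add) auto
      then show ?thesis unfolding 2(1) by (rule eq[OF proj[OF CX_closed(2)[OF X 2(2)]]])
    next
      case (3 \<psi> \<phi>)
      have "continuous_map ?P euclideanreal (\<lambda>\<mu>. max (\<mu> \<psi>) (\<mu> \<phi>))"
        by (intro continuous_map_real_max proj 3)
      then show ?thesis unfolding 3(1) by (rule eq[OF proj[OF CX_closed(3)[OF X 3(2,3)]]])
    qed
  qed
  moreover have "\<K> \<noteq> {}" by (auto simp: \<K>_def)
  ultimately have cl: "closedin ?P (\<Inter>\<K>)" by (intro closedin_Inter)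
  have "?S = \<Inter>\<K>"
  proof (intro set_eqI)
    fix \<mu> :: "('a \<Rightarrow> real) \<Rightarrow> real"
    have "\<mu> \<in> topspace ?P \<longleftrightarrow> \<mu> \<in> extensional (CX X)" by (simp add: PiE_def)
    then have "\<mu> \<in> \<Inter>\<K> \<longleftrightarrow> idempotent_measure X \<mu>"
      unfolding \<K>_def idempotent_measure_def
      by (simp only: Inter_Un_distrib Int_iff Inter_iff ball_simps mem_Collect_eq Un_iff
          insert_iff empty_iff) blast
    then show "\<mu> \<in> ?S \<longleftrightarrow> \<mu> \<in> \<Inter>\<K>" by simp
  qed
  then have cl: "closedin ?P ?S" using cl by simp
  have "\<exists>B. \<forall>x\<in>topspace X. \<bar>\<phi> x\<bar> \<le> B" if "\<phi> \<in> CX X" for \<phi>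
  proof -
    have "compact (\<phi> ` topspace X)"
      using image_compactin[of X "topspace X" euclideanreal \<phi>] X that mem_CX_iff[OF X]
      by (simp add: compact_space_def)
    then show ?thesis
      using compact_imp_bounded by (force simp: bounded_iff)
  qed
  then obtain B where B: "\<And>\<phi> x. \<phi> \<in> CX X \<Longrightarrow> x \<in> topspace X \<Longrightarrow> \<bar>\<phi> x\<bar> \<le> B \<phi>"
    by metis
  have "compactin ?P (\<Pi>\<^sub>E \<phi>\<in>CX X. {- B \<phi>..B \<phi>})"
    by (simp add: compactin_PiE)
  moreover have "?S \<subseteq> (\<Pi>\<^sub>E \<phi>\<in>CX X. {- B \<phi>..B \<phi>})"
  proof clarify
    fix \<mu> assume \<mu>: "idempotent_measure X \<mu>"
    then have "\<mu> \<phi> \<in> {- B \<phi>..B \<phi>}" if "\<phi> \<in> CX X" for \<phi>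
      using idempotent_measure_bound[OF X \<mu> that B[OF that]] by (simp add: abs_le_iff minus_le_iff)
    then show "\<mu> \<in> (\<Pi>\<^sub>E \<phi>\<in>CX X. {- B \<phi>..B \<phi>})"
      using \<mu> unfolding idempotent_measure_def by (simp only: PiE_iff) blast
  qed
  ultimately have "compactin ?P ?S" using cl closed_compactin by metis
  then show "compact_space (IX X)"
    unfolding IX_def by (rule compact_space_subtopology)
qed

lemma tilde_in_CX:
  assumes X: "compact_space X" and \<phi>: "\<phi> \<in> CX X"
  shows "tilde X \<phi> \<in> CX (IX X)"
proof -
  have "continuous_map (IX X) euclideanreal (\<lambda>\<nu>. \<nu> \<phi>)"
    using continuous_map_product_projection[OF \<phi>, of "\<lambda>_. euclideanreal"]
    unfolding IX_def by (rule continuous_map_from_subtopology)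
  then have "continuous_map (IX X) euclideanreal (tilde X \<phi>)"
    by (rule continuous_map_eq) (simp add: tilde_def)
  then show ?thesis
    unfolding mem_CX_iff[OF IX_compactum(1)[OF X]] by (simp add: tilde_def)
qed

lemma continuous_map_idem_barycenter:
  assumes X: "compact_space X"
  shows "continuous_map (IX (IX X)) (IX X) (idem_barycenter X)"
proof -
  note IX = IX_compactum(1)[OF X]
  have t1: "tilde X (cst X 1) = cst (IX X) 1"
    unfolding tilde_def cst_def[of "IX X"] topspace_IX
    by (rule restrict_ext) (simp add: idempotent_measure_def)
  have t2: "tilde X (odot X l \<phi>) = odot (IX X) l (tilde X \<phi>)" if "\<phi> \<in> CX X" for l \<phi>
    using that unfolding tilde_def odot_def[of "IX X"] topspace_IX
    by (intro restrict_ext) (simp add: idempotent_measure_def)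
  have t3: "tilde X (oplus X \<psi> \<phi>) = oplus (IX X) (tilde X \<psi>) (tilde X \<phi>)"
    if "\<psi> \<in> CX X" "\<phi> \<in> CX X" for \<psi> \<phi>
    using that unfolding tilde_def oplus_def[of "IX X"] topspace_IX
    by (intro restrict_ext) (simp add: idempotent_measure_def)
  have meas: "idempotent_measure X (idem_barycenter X M)" if M: "idempotent_measure (IX X) M" for M
  proof -
    have b: "idem_barycenter X M \<phi> = M (tilde X \<phi>)" if "\<phi> \<in> CX X" for \<phi>
      using that unfolding idem_barycenter_def by (rule restrict_apply')
    show ?thesis
      unfolding idempotent_measure_def
    proof (intro conjI ballI allI)
      show "idem_barycenter X M \<in> extensional (CX X)"
        unfolding idem_barycenter_def by (rule restrict_extensional)
      show "idem_barycenter X M (cst X 1) = 1"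
        using M unfolding b[OF CX_closed(1)[OF X]] t1 idempotent_measure_def by blast
      show "idem_barycenter X M (odot X l \<phi>) = l + idem_barycenter X M \<phi>" if \<phi>: "\<phi> \<in> CX X" for l \<phi>
        using M tilde_in_CX[OF X \<phi>]
        unfolding b[OF CX_closed(2)[OF X \<phi>]] b[OF \<phi>] t2[OF \<phi>] idempotent_measure_def by blast
      show "idem_barycenter X M (oplus X \<psi> \<phi>) = max (idem_barycenter X M \<psi>) (idem_barycenter X M \<phi>)"
        if \<psi>: "\<psi> \<in> CX X" and \<phi>: "\<phi> \<in> CX X" for \<psi> \<phi>
        using M tilde_in_CX[OF X \<phi>] tilde_in_CX[OF X \<psi>]
        unfolding b[OF CX_closed(3)[OF X \<psi> \<phi>]] b[OF \<phi>] b[OF \<psi>] t3[OF \<psi> \<phi>] idempotent_measure_def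
        by blast
    qed
  qed
  have "continuous_map (IX (IX X)) euclideanreal (\<lambda>M. idem_barycenter X M \<phi>)" if \<phi>: "\<phi> \<in> CX X" for \<phi>
  proof -
    have "continuous_map (IX (IX X)) euclideanreal (\<lambda>M. M (tilde X \<phi>))"
      using continuous_map_product_projection[OF tilde_in_CX[OF X \<phi>], of "\<lambda>_. euclideanreal"]
      unfolding IX_def[of "IX X"] by (rule continuous_map_from_subtopology)
    moreover have "idem_barycenter X M \<phi> = M (tilde X \<phi>)" for M
      using \<phi> unfolding idem_barycenter_def by (rule restrict_apply')
    ultimately show ?thesis by simp
  qed
  moreover have "idem_barycenter X ` topspace (IX (IX X)) \<subseteq> extensional (CX X)"
    unfolding idem_barycenter_def by (blast intro: restrict_extensional)
  moreover have "idem_barycenter X \<in> topspace (IX (IX X)) \<rightarrow> {\<mu>. idempotent_measure X \<mu>}"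
    using meas by (auto simp: topspace_IX)
  ultimately show ?thesis
    unfolding IX_def[of X] continuous_map_in_subtopology continuous_map_componentwise by blast
qed

section \<open>Softness\<close>

definition paracompact_space :: "'a topology \<Rightarrow> bool" where
  "paracompact_space Z \<longleftrightarrow> Hausdorff_space Z \<and>
     (\<forall>\<U>. (\<forall>U\<in>\<U>. openin Z U) \<and> \<Union>\<U> = topspace Z \<longrightarrow>
        (\<exists>\<V>. (\<forall>V\<in>\<V>. openin Z V) \<and> \<Union>\<V> = topspace Z \<and>
             (\<forall>V\<in>\<V>. \<exists>U\<in>\<U>. V \<subseteq> U) \<and> locally_finite_in Z \<V>))"

text \<open>Covering dimension (at most) zero: a finite open cover of order one is a disjoint one. The
  empty space, whose dimension is sometimes taken to be \<open>-1\<close>, is included; it poses no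
  condition in the definition of softness.\<close>

definition zero_dimensional :: "'a topology \<Rightarrow> bool" where
  "zero_dimensional Z \<longleftrightarrow>
     (\<forall>\<U>. finite \<U> \<and> (\<forall>U\<in>\<U>. openin Z U) \<and> \<Union>\<U> = topspace Z \<longrightarrow>
        (\<exists>\<V>. finite \<V> \<and> (\<forall>V\<in>\<V>. openin Z V) \<and> \<Union>\<V> = topspace Z \<and>
             (\<forall>V\<in>\<V>. \<exists>U\<in>\<U>. V \<subseteq> U) \<and> pairwise disjnt \<V>))"

definition soft_wrt :: "'z topology \<Rightarrow> 'a topology \<Rightarrow> 'b topology \<Rightarrow> ('a \<Rightarrow> 'b) \<Rightarrow> bool" where
  "soft_wrt Z X Y f \<longleftrightarrow>
     (\<forall>A \<Phi> \<Psi>. closedin Z A \<and> continuous_map (subtopology Z A) X \<Phi> \<and> continuous_map Z Y \<Psi> \<and>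
        (\<forall>a\<in>A. \<Psi> a = f (\<Phi> a)) \<longrightarrow>
        (\<exists>G. continuous_map Z X G \<and> (\<forall>a\<in>A. G a = \<Phi> a) \<and> (\<forall>z\<in>topspace Z. \<Psi> z = f (G z))))"

text \<open>A formula cannot quantify over all types, so the test spaces \<open>Z\<close> range over all topologies
  with points in one type, which has to be chosen large enough. For compacta \<open>X\<close> and \<open>Y\<close> this is
  no restriction: theorem \<open>zero_soft_imp_soft_wrt\<close> below shows that then \<open>Z\<close> may be any
  zero-dimensional paracompact space on any type.\<close>

type_synonym ('a, 'b) test_point = "('a set \<times> 'a set) + ('b set \<times> 'b set) \<Rightarrow> bool"

definition zero_soft :: "'a topology \<Rightarrow> 'b topology \<Rightarrow> ('a \<Rightarrow> 'b) \<Rightarrow> bool" where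
  "zero_soft X Y f \<longleftrightarrow> continuous_map X Y f \<and>
     (\<forall>Z :: ('a, 'b) test_point topology.
        zero_dimensional Z \<and> paracompact_space Z \<longrightarrow> soft_wrt Z X Y f)"

subsection \<open>Independence of the type of test points\<close>

lemma compact_Hausdorff_imp_paracompact_space:
  assumes "compact_space Z" "Hausdorff_space Z"
  shows "paracompact_space Z"
  unfolding paracompact_space_def
proof (intro conjI allI impI)
  fix \<U> assume U: "(\<forall>U\<in>\<U>. openin Z U) \<and> \<Union>\<U> = topspace Z"
  then obtain \<F> where F: "finite \<F>" "\<F> \<subseteq> \<U>" "topspace Z \<subseteq> \<Union>\<F>"
    using assms(1) unfolding compact_space_alt by (metis subset_refl)
  have eq: "\<Union>\<F> = topspace Z"
    using F(3) Union_mono[OF F(2)] U by auto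
  have lf: "locally_finite_in Z \<F>"
    using F(1) eq by (simp add: finite_imp_locally_finite_in)
  show "\<exists>\<V>. (\<forall>V\<in>\<V>. openin Z V) \<and> \<Union>\<V> = topspace Z \<and>
             (\<forall>V\<in>\<V>. \<exists>U\<in>\<U>. V \<subseteq> U) \<and> locally_finite_in Z \<V>"
  proof (intro exI conjI ballI)
    show "openin Z V" if "V \<in> \<F>" for V using subsetD[OF F(2) that] U by simp
    show "\<exists>U\<in>\<U>. V \<subseteq> U" if "V \<in> \<F>" for V using subsetD[OF F(2) that] by (rule bexI[rotated]) simp
  qed (rule eq lf)+
qed (rule assms(2))

lemma clopen_disjoint_refinement:
  assumes "finite \<F>" "\<forall>F\<in>\<F>. closedin Z F \<and> openin Z F"
  shows "\<exists>\<V>. finite \<V> \<and> (\<forall>V\<in>\<V>. closedin Z V \<and> openin Z V) \<and> \<Union>\<V> = \<Union>\<F> \<and>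
            (\<forall>V\<in>\<V>. \<exists>F\<in>\<F>. V \<subseteq> F) \<and> pairwise disjnt \<V>"
  using assms
proof (induction \<F> rule: finite_induct)
  case empty
  then show ?case by (intro exI[of _ "{}"]) auto
next
  case (insert F \<F>)
  then obtain \<V> where V: "finite \<V>" "\<forall>V\<in>\<V>. closedin Z V \<and> openin Z V" "\<Union>\<V> = \<Union>\<F>"
      "\<forall>V\<in>\<V>. \<exists>F\<in>\<F>. V \<subseteq> F" "pairwise disjnt \<V>"
    by auto
  let ?W = "F - \<Union>\<F>"
  have "closedin Z (\<Union>\<F>)" "openin Z (\<Union>\<F>)"
    using insert by (auto intro!: closedin_Union)
  then have W: "closedin Z ?W \<and> openin Z ?W"
    using insert.prems by (simp add: closedin_diff openin_diff)
  show ?case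
  proof (intro exI[of _ "insert ?W \<V>"] conjI)
    show "pairwise disjnt (insert ?W \<V>)"
      unfolding pairwise_insert using V(3,5) by (auto simp: disjnt_def)
    show "\<forall>V\<in>insert ?W \<V>. \<exists>F\<in>insert F \<F>. V \<subseteq> F" using V(4) by auto
  qed (use V W in auto)
qed

lemma zero_dimensional_if_clopen_base:
  assumes "compact_space Z"
    and base: "\<And>U x. openin Z U \<Longrightarrow> x \<in> U \<Longrightarrow>
                 \<exists>B. closedin Z B \<and> openin Z B \<and> x \<in> B \<and> B \<subseteq> U"
  shows "zero_dimensional Z"
  unfolding zero_dimensional_def
proof (intro allI impI)
  fix \<U> assume U: "finite \<U> \<and> (\<forall>U\<in>\<U>. openin Z U) \<and> \<Union>\<U> = topspace Z"
  let ?B = "{B. closedin Z B \<and> openin Z B \<and> (\<exists>U\<in>\<U>. B \<subseteq> U)}"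
  have "topspace Z \<subseteq> \<Union>?B"
  proof
    fix x assume "x \<in> topspace Z"
    then obtain U where "U \<in> \<U>" "x \<in> U" using U by blast
    then show "x \<in> \<Union>?B" using base[of U x] U by blast
  qed
  then obtain \<F> where F: "finite \<F>" "\<F> \<subseteq> ?B" "topspace Z \<subseteq> \<Union>\<F>"
    using assms(1)[unfolded compact_space_alt, rule_format, of ?B] by auto
  have clF: "\<forall>F\<in>\<F>. closedin Z F \<and> openin Z F"
    using F(2) by auto
  obtain \<V> where V: "finite \<V>" "\<forall>V\<in>\<V>. closedin Z V \<and> openin Z V" "\<Union>\<V> = \<Union>\<F>"
      "\<forall>V\<in>\<V>. \<exists>F\<in>\<F>. V \<subseteq> F" "pairwise disjnt \<V>"
    using clopen_disjoint_refinement[OF F(1) clF] by (elim exE conjE) (rule that; assumption)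
  have "\<Union>\<F> = topspace Z" using F(2,3) openin_subset by blast
  moreover have "\<exists>U\<in>\<U>. V \<subseteq> U" if VV: "V \<in> \<V>" for V
  proof -
    obtain B where B: "B \<in> \<F>" "V \<subseteq> B" using V(4) VV by auto
    then have "B \<in> ?B" using F(2) by (rule_tac subsetD)
    then obtain U where "U \<in> \<U>" "B \<subseteq> U" by auto
    then show ?thesis using B(2) by auto
  qed
  ultimately show "\<exists>\<V>. finite \<V> \<and> (\<forall>V\<in>\<V>. openin Z V) \<and> \<Union>\<V> = topspace Z \<and>
             (\<forall>V\<in>\<V>. \<exists>U\<in>\<U>. V \<subseteq> U) \<and> pairwise disjnt \<V>"
    using V(1,2,3,5) by (intro exI[of _ \<V>]) simp
qed

lemma zero_dimensional_separation:
  assumes "zero_dimensional Z" "closedin Z E" "closedin Z F" "E \<inter> F = {}"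
  shows "\<exists>C. closedin Z C \<and> openin Z C \<and> E \<subseteq> C \<and> C \<inter> F = {}"
proof -
  let ?U = "{topspace Z - E, topspace Z - F}"
  have U: "finite ?U \<and> (\<forall>U\<in>?U. openin Z U) \<and> \<Union>?U = topspace Z"
    using assms by auto
  then obtain \<V> where V: "finite \<V>" "\<forall>V\<in>\<V>. openin Z V" "\<Union>\<V> = topspace Z"
      "\<forall>V\<in>\<V>. \<exists>U\<in>?U. V \<subseteq> U" "pairwise disjnt \<V>"
    using assms(1)[unfolded zero_dimensional_def, rule_format, OF U]
    by (elim exE conjE) (rule that; assumption)
  define C where "C = \<Union>{V\<in>\<V>. V \<inter> E \<noteq> {}}"
  define D where "D = \<Union>{V\<in>\<V>. V \<inter> E = {}}"
  have op: "openin Z C" "openin Z D" using V(2) by (auto simp: C_def D_def)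
  have "C \<inter> D = {}" using V(5) by (fastforce simp: C_def D_def pairwise_def disjnt_def)
  moreover have "C \<union> D = topspace Z" unfolding V(3)[symmetric] C_def D_def by auto
  ultimately have "C = topspace Z - D" by blast
  then have "closedin Z C" using op(2) by (simp add: closedin_diff)
  moreover have "E \<subseteq> C"
    using closedin_subset[OF assms(2)] unfolding V(3)[symmetric] C_def by auto
  moreover have "C \<inter> F = {}"
  proof -
    have "V \<inter> F = {}" if "V \<in> \<V>" "V \<inter> E \<noteq> {}" for V using V(4) that by auto
    then show ?thesis by (auto simp: C_def)
  qed
  ultimately show ?thesis using op(1) by blast
qed

abbreviation cube :: "('i \<Rightarrow> bool) topology" where
  "cube \<equiv> product_topology (\<lambda>_. discrete_topology UNIV) UNIV"

lemma cube_space: "compact_space cube" "Hausdorff_space cube" "topspace cube = UNIV"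
  by (auto simp: compact_space_product_topology Hausdorff_space_product_topology
      compact_space_discrete_topology)

lemma closedin_cube_UNIV: "closedin cube (UNIV :: ('i \<Rightarrow> bool) set)"
  using closedin_topspace[of "cube :: ('i \<Rightarrow> bool) topology"] unfolding cube_space(3) .

lemma openin_cube_coord: "openin cube {z. P (z i)}"
  using openin_continuous_map_preimage[OF continuous_map_product_projection[of i UNIV
      "\<lambda>_. discrete_topology (UNIV :: bool set)"], of "{b. P b}"]
  by simp

lemma closedin_cube_coord: "closedin cube {z. P (z i)}"
  using openin_cube_coord[of "\<lambda>b. \<not> P b" i] by (simp add: closedin_def Compl_eq Diff_eq)

lemma zero_dimensional_closed_cube:
  assumes "closedin cube S"
  shows "zero_dimensional (subtopology cube S)" "paracompact_space (subtopology cube S)"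
proof -
  have comp: "compact_space (subtopology cube S)"
    using assms cube_space(1) closedin_compact_space compact_space_subtopology by blast
  then show "paracompact_space (subtopology cube S)"
    by (intro compact_Hausdorff_imp_paracompact_space)
      (auto simp: Hausdorff_space_subtopology cube_space)
  show "zero_dimensional (subtopology cube S)"
  proof (rule zero_dimensional_if_clopen_base[OF comp])
    fix U x assume U: "openin (subtopology cube S) U" "x \<in> U"
    then obtain T where T: "openin cube T" "U = T \<inter> S" by (auto simp: openin_subtopology)
    then obtain W where W: "finite {i. W i \<noteq> (UNIV::bool set)}" "x \<in> Pi\<^sub>E UNIV W" "Pi\<^sub>E UNIV W \<subseteq> T"
      using U(2) unfolding openin_product_topology_alt by force
    let ?J = "{i. W i \<noteq> UNIV}"
    have eq: "Pi\<^sub>E UNIV W = topspace cube - (\<Union>i\<in>?J. {z. z i \<notin> W i})"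
      by (auto simp: PiE_iff)
    have "openin cube (\<Union>i\<in>?J. {z. z i \<notin> W i})"
      by (intro openin_Union ballI) (auto intro: openin_cube_coord)
    moreover have "closedin cube (\<Union>i\<in>?J. {z. z i \<notin> W i})"
      using W(1) by (intro closedin_Union) (auto intro: closedin_cube_coord)
    ultimately have "closedin cube (Pi\<^sub>E UNIV W)" "openin cube (Pi\<^sub>E UNIV W)"
      unfolding eq by blast+
    then show "\<exists>B. closedin (subtopology cube S) B \<and> openin (subtopology cube S) B \<and> x \<in> B \<and> B \<subseteq> U"
      using W U(2) T(2)
      by (intro exI[of _ "Pi\<^sub>E UNIV W \<inter> S"]) (auto simp: closedin_subtopology openin_subtopology)
  qed
qed

text \<open>Each coordinate of the cube decides for one binary open cover \<open>{U, V}\<close> of \<open>X\<close>; a point of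
  \<open>X\<close> is coded by every consistent sequence of decisions.\<close>

definition codes :: "'a topology \<Rightarrow> ('a set \<times> 'a set \<Rightarrow> 'i) \<Rightarrow> ('i \<Rightarrow> bool) \<Rightarrow> 'a \<Rightarrow> bool" where
  "codes X j z x \<longleftrightarrow> x \<in> topspace X \<and>
     (\<forall>U V. openin X U \<and> openin X V \<and> U \<union> V = topspace X \<longrightarrow>
        x \<in> X closure_of (if z (j (U, V)) then U else V))"

lemma codes_unique:
  assumes "compact_space X" "Hausdorff_space X" "codes X j z x" "codes X j z y"
  shows "x = y"
proof (rule ccontr)
  assume "x \<noteq> y"
  have xy: "x \<in> topspace X" "y \<in> topspace X" using assms by (auto simp: codes_def)
  then obtain P Q where PQ: "openin X P" "openin X Q" "x \<in> P" "y \<in> Q" "disjnt P Q"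
    using assms(2) \<open>x \<noteq> y\<close> by (meson Hausdorff_space_def)
  have "regular_space X" using assms by (simp add: compact_Hausdorff_imp_regular_space)
  moreover have "closedin X (topspace X - P)" "x \<in> topspace X - (topspace X - P)"
    using PQ xy by auto
  ultimately obtain P' where P': "openin X P'" "x \<in> P'" "disjnt (topspace X - P) (X closure_of P')"
    unfolding regular_space by meson
  then have P'P: "X closure_of P' \<subseteq> P"
    using closure_of_subset_topspace[of X P'] by (auto simp: disjnt_iff)
  let ?U = "topspace X - X closure_of P'"
  have "x \<notin> X closure_of ?U"
    using P' closure_of_subset[OF openin_subset[OF P'(1)]] by (auto simp: in_closure_of)
  moreover have "y \<notin> X closure_of P"
    using PQ by (auto simp: in_closure_of disjnt_iff)
  moreover have "openin X ?U" by (simp add: openin_diff)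
  moreover have "?U \<union> P = topspace X" using P'P openin_subset[OF PQ(1)] by blast
  moreover have "w \<in> X closure_of (if z (j (U, V)) then U else V)"
    if "openin X U" "openin X V" "U \<union> V = topspace X" "codes X j z w" for U V w
    using that by (simp add: codes_def)
  from this[of ?U P x] this[of ?U P y]
  have "openin X ?U \<Longrightarrow> ?U \<union> P = topspace X \<Longrightarrow> x \<in> X closure_of ?U \<or> y \<in> X closure_of P"
    using assms(3,4) PQ(1) by (auto split: if_splits)
  ultimately show False by blast
qed

lemma decode:
  fixes X :: "'a topology" and j :: "'a set \<times> 'a set \<Rightarrow> 'i"
  assumes X: "compact_space X" "Hausdorff_space X"
  defines "D \<equiv> {z. \<exists>x. codes X j z x}"
  shows "closedin cube D"
    "\<exists>F. continuous_map (subtopology cube D) X F \<and> (\<forall>z x. codes X j z x \<longrightarrow> F z = x)"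
proof -
  let ?P = "prod_topology (cube :: ('i \<Rightarrow> bool) topology) X"
  have closed_S: "closedin ?P {p \<in> topspace ?P. codes X j (fst p) (snd p) \<and> snd p \<in> S}"
    if S: "closedin X S" for S
  proof -
    define K where "K U V = ({z. z (j (U, V))} \<times> X closure_of U) \<union>
        ({z. \<not> z (j (U, V))} \<times> X closure_of V)" for U V
    define \<K> where "\<K> = {K U V | U V. openin X U \<and> openin X V \<and> U \<union> V = topspace X}"
    have "closedin ?P (K U V)" for U V
      unfolding K_def
      by (intro closedin_Un) (simp_all add: closedin_prod_Times_iff
          closedin_cube_coord[of "\<lambda>b. b"] closedin_cube_coord[of Not])
    then have "closedin ?P k" if "k \<in> \<K>" for k
      using that by (auto simp: \<K>_def)
    moreover have US: "closedin ?P (UNIV \<times> S)"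
      using S by (simp add: closedin_prod_Times_iff closedin_cube_UNIV)
    ultimately have "closedin ?P (\<Inter>(insert (UNIV \<times> S) \<K>))"
      by (intro closedin_Inter) auto
    moreover have "{p \<in> topspace ?P. codes X j (fst p) (snd p) \<and> snd p \<in> S} =
        \<Inter>(insert (UNIV \<times> S) \<K>)"
    proof (intro set_eqI)
      fix p :: "('i \<Rightarrow> bool) \<times> 'a"
      obtain z x where p: "p = (z, x)" by fastforce
      have pK: "p \<in> K U V \<longleftrightarrow> x \<in> X closure_of (if z (j (U, V)) then U else V)" for U V
        by (simp add: K_def p)
      have "(\<forall>k\<in>\<K>. p \<in> k) \<longleftrightarrow>
          (\<forall>U V. openin X U \<and> openin X V \<and> U \<union> V = topspace X \<longrightarrow> p \<in> K U V)"
        by (auto simp: \<K>_def)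
      then have "(\<forall>k\<in>\<K>. p \<in> k) \<longleftrightarrow> codes X j z x"
        if "x \<in> topspace X"
        using that unfolding codes_def pK by simp
      moreover have "x \<in> topspace X" if "x \<in> S" using that closedin_subset[OF S] by auto
      ultimately show "p \<in> {p \<in> topspace ?P. codes X j (fst p) (snd p) \<and> snd p \<in> S} \<longleftrightarrow>
          p \<in> \<Inter>(insert (UNIV \<times> S) \<K>)"
        by (auto simp: p cube_space simp del: topspace_product_topology)
    qed
    ultimately show ?thesis by simp
  qed
  have img: "closedin cube {z. \<exists>x\<in>S. codes X j z x}" if S: "closedin X S" for S
  proof -
    have "{z. \<exists>x\<in>S. codes X j z x} =
        fst ` {p \<in> topspace ?P. codes X j (fst p) (snd p) \<and> snd p \<in> S}" (is "_ = fst ` ?Q")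
    proof (intro set_eqI iffI)
      fix z assume "z \<in> {z. \<exists>x\<in>S. codes X j z x}"
      then obtain x where "x \<in> S" "codes X j z x" by auto
      then have "(z, x) \<in> ?Q" using closedin_subset[OF S] by (auto simp: cube_space)
      then show "z \<in> fst ` ?Q" by (rule image_eqI[rotated]) simp
    qed auto
    then show ?thesis
      using closed_map_fst[OF X(1), of "cube :: ('i \<Rightarrow> bool) topology"] closed_S[OF S]
      unfolding closed_map_def by simp
  qed
  have "D = {z. \<exists>x\<in>topspace X. codes X j z x}" by (auto simp: D_def codes_def)
  then show D: "closedin cube D" using img[of "topspace X"] by simp
  define F where "F = (\<lambda>z. THE x. codes X j z x)"
  have F: "F z = x" if "codes X j z x" for z x
    unfolding F_def using that codes_unique[OF X] by (metis the_equality)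
  have "continuous_map (subtopology cube D) X F"
    unfolding continuous_map_closedin
  proof (intro conjI allI impI)
    show "F \<in> topspace (subtopology cube D) \<rightarrow> topspace X"
      using F by (auto simp: D_def codes_def)
    fix S assume S: "closedin X S"
    have "{z \<in> topspace (subtopology cube D). F z \<in> S} = {z. \<exists>x\<in>S. codes X j z x} \<inter> D"
      using F by (auto simp: D_def cube_space)
    then show "closedin (subtopology cube D) {z \<in> topspace (subtopology cube D). F z \<in> S}"
      using img[OF S] by (auto simp: closedin_subtopology)
  qed
  then show "\<exists>F. continuous_map (subtopology cube D) X F \<and> (\<forall>z x. codes X j z x \<longrightarrow> F z = x)"
    using F by blast
qed

lemma encode:
  assumes Z: "zero_dimensional Z" and A: "closedin Z A"
    and \<Phi>: "continuous_map (subtopology Z A) X \<Phi>"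
  shows "\<exists>c. (\<forall>p. closedin Z (c p) \<and> openin Z (c p)) \<and>
             (\<forall>a\<in>A. \<forall>z. (\<forall>p. z (j p) \<longleftrightarrow> a \<in> c p) \<longrightarrow> codes X j z (\<Phi> a))"
proof -
  have tA: "topspace (subtopology Z A) = A" using closedin_subset[OF A] by auto
  have pre: "closedin Z {a\<in>A. \<Phi> a \<notin> U}" if "openin X U" for U
  proof -
    have "closedin X (topspace X - U)" using that by auto
    from closedin_continuous_map_preimage[OF \<Phi> this]
    have "closedin (subtopology Z A) {a \<in> A. \<Phi> a \<in> topspace X - U}"
      unfolding tA .
    moreover have "{a \<in> A. \<Phi> a \<in> topspace X - U} = {a\<in>A. \<Phi> a \<notin> U}"
      using continuous_map_image_subset_topspace[OF \<Phi>] tA by auto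
    ultimately show ?thesis using A closedin_trans_full[of Z A] by simp
  qed
  have "\<exists>C. closedin Z C \<and> openin Z C \<and>
        (openin X U \<and> openin X V \<and> U \<union> V = topspace X \<longrightarrow>
          (\<forall>a\<in>A. if a \<in> C then \<Phi> a \<in> U else \<Phi> a \<in> V))" for U V
  proof (cases "openin X U \<and> openin X V \<and> U \<union> V = topspace X")
    case True
    have "{a\<in>A. \<Phi> a \<notin> V} \<inter> {a\<in>A. \<Phi> a \<notin> U} = {}"
      using True continuous_map_image_subset_topspace[OF \<Phi>] tA by auto
    from zero_dimensional_separation[OF Z pre pre this] True
    obtain C where "closedin Z C" "openin Z C" "{a\<in>A. \<Phi> a \<notin> V} \<subseteq> C" "C \<inter> {a\<in>A. \<Phi> a \<notin> U} = {}"
      by auto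
    then show ?thesis by (intro exI[of _ C]) auto
  qed (auto intro: exI[of _ "{}"])
  then have "\<forall>p. \<exists>C. closedin Z C \<and> openin Z C \<and>
        (openin X (fst p) \<and> openin X (snd p) \<and> fst p \<union> snd p = topspace X \<longrightarrow>
          (\<forall>a\<in>A. if a \<in> C then \<Phi> a \<in> fst p else \<Phi> a \<in> snd p))"
    by blast
  then obtain c where c: "\<And>p. closedin Z (c p) \<and> openin Z (c p) \<and>
        (openin X (fst p) \<and> openin X (snd p) \<and> fst p \<union> snd p = topspace X \<longrightarrow>
          (\<forall>a\<in>A. if a \<in> c p then \<Phi> a \<in> fst p else \<Phi> a \<in> snd p))"
    by metis
  have "codes X j z (\<Phi> a)" if a: "a \<in> A" and z: "\<forall>p. z (j p) \<longleftrightarrow> a \<in> c p" for a z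
    unfolding codes_def
  proof (intro conjI allI impI)
    show "\<Phi> a \<in> topspace X" using a continuous_map_image_subset_topspace[OF \<Phi>] tA by auto
    fix U V assume UV: "openin X U \<and> openin X V \<and> U \<union> V = topspace X"
    then have "if a \<in> c (U, V) then \<Phi> a \<in> U else \<Phi> a \<in> V" using c[of "(U, V)"] a by auto
    then show "\<Phi> a \<in> X closure_of (if z (j (U, V)) then U else V)"
      using z UV closure_of_subset[of U X] closure_of_subset[of V X] openin_subset[of X]
      by (auto split: if_splits)
  qed
  then show ?thesis using c by blast
qed

theorem zero_soft_imp_soft_wrt:
  fixes Z :: "'z topology"
  assumes X: "compact_space X" "Hausdorff_space X" and Y: "compact_space Y" "Hausdorff_space Y"
    and f: "zero_soft X Y f" and Z: "zero_dimensional Z" "paracompact_space Z"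
  shows "soft_wrt Z X Y f"
  unfolding soft_wrt_def
proof (intro allI impI, elim conjE)
  fix A \<Phi> \<Psi>
  assume A: "closedin Z A" and \<Phi>: "continuous_map (subtopology Z A) X \<Phi>"
    and \<Psi>: "continuous_map Z Y \<Psi>" and eq: "\<forall>a\<in>A. \<Psi> a = f (\<Phi> a)"
  let ?jX = "Inl :: _ \<Rightarrow> ('a set \<times> 'a set) + ('b set \<times> 'b set)"
    and ?jY = "Inr :: _ \<Rightarrow> ('a set \<times> 'a set) + ('b set \<times> 'b set)"
  define DX where "DX = {z. \<exists>x. codes X ?jX z x}"
  define DY where "DY = {z. \<exists>y. codes Y ?jY z y}"
  obtain FX where FX: "continuous_map (subtopology cube DX) X FX" "\<And>z x. codes X ?jX z x \<Longrightarrow> FX z = x"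
    using decode(2)[OF X, of ?jX] unfolding DX_def by blast
  obtain FY where FY: "continuous_map (subtopology cube DY) Y FY" "\<And>z x. codes Y ?jY z x \<Longrightarrow> FY z = x"
    using decode(2)[OF Y, of ?jY] unfolding DY_def by blast
  have cl: "closedin cube DX" "closedin cube DY"
    using decode(1)[OF X] decode(1)[OF Y] unfolding DX_def DY_def by blast+
  obtain cX where cX: "\<And>p. closedin Z (cX p) \<and> openin Z (cX p)"
      "\<And>a z. a \<in> A \<Longrightarrow> (\<And>p. z (?jX p) \<longleftrightarrow> a \<in> cX p) \<Longrightarrow> codes X ?jX z (\<Phi> a)"
    using encode[OF Z(1) A \<Phi>, of ?jX] by blast
  have \<Psi>': "continuous_map (subtopology Z (topspace Z)) Y \<Psi>"
    using \<Psi> by (simp add: subtopology_topspace)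
  obtain cY where cY: "\<And>p. closedin Z (cY p) \<and> openin Z (cY p)"
      "\<And>a z. a \<in> topspace Z \<Longrightarrow> (\<And>p. z (?jY p) \<longleftrightarrow> a \<in> cY p) \<Longrightarrow> codes Y ?jY z (\<Psi> a)"
    using encode[OF Z(1) closedin_topspace \<Psi>', of ?jY] by blast
  define e where "e a i = (case i of Inl p \<Rightarrow> a \<in> cX p | Inr p \<Rightarrow> a \<in> cY p)" for a i
  have eX: "codes X ?jX (e a) (\<Phi> a)" if "a \<in> A" for a
    using cX(2)[OF that, of "e a"] by (simp add: e_def)
  have eY: "codes Y ?jY (e a) (\<Psi> a)" if "a \<in> topspace Z" for a
    using cY(2)[OF that, of "e a"] by (simp add: e_def)
  have e_cont: "continuous_map Z cube e"
    unfolding continuous_map_componentwise_UNIV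
  proof
    fix i
    define E where "E = {a. e a i}"
    have clop: "closedin Z E" "openin Z E"
      unfolding E_def using cX(1) cY(1) by (cases i; simp add: e_def)+
    have "e x i \<in> S \<longleftrightarrow> (if x \<in> E then True \<in> S else False \<in> S)" for x S
      by (simp add: E_def)
    then have "{x \<in> topspace Z. e x i \<in> S} =
        (if True \<in> S then E else {}) \<union> (if False \<in> S then topspace Z - E else {})" for S
      using openin_subset[OF clop(2)] by auto
    then have "openin Z {x \<in> topspace Z. e x i \<in> S}" for S
      using clop by (auto intro!: openin_Un openin_diff)
    then show "continuous_map Z (discrete_topology UNIV) (\<lambda>x. e x i)"
      by (auto simp: continuous_map_def)
  qed
  let ?Z = "subtopology cube DY"
  define A' where "A' = {z \<in> DX \<inter> DY. FY z = f (FX z)}"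
  have fcont: "continuous_map X Y f" using f by (simp add: zero_soft_def)
  have DXY: "closedin cube (DX \<inter> DY)" using cl by (rule closedin_Int)
  have "closedin (subtopology cube (DX \<inter> DY)) {z \<in> topspace (subtopology cube (DX \<inter> DY)). FY z = (f \<circ> FX) z}"
  proof (rule closedin_continuous_maps_eq[OF Y(2)])
    show "continuous_map (subtopology cube (DX \<inter> DY)) Y FY"
      using FY(1) by (rule continuous_map_from_subtopology_mono) simp
    show "continuous_map (subtopology cube (DX \<inter> DY)) Y (f \<circ> FX)"
      by (rule continuous_map_compose[OF continuous_map_from_subtopology_mono[OF FX(1)] fcont]) simp
  qed
  then have "closedin cube A'"
    using DXY by (simp add: A'_def cube_space closedin_closed_subtopology)
  then have A': "closedin ?Z A'"
    by (rule closedin_subset_topspace) (auto simp: A'_def)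
  have "soft_wrt ?Z X Y f"
    using f zero_dimensional_closed_cube[OF cl(2)] by (simp add: zero_soft_def)
  moreover have "continuous_map (subtopology ?Z A') X FX"
    using FX(1) unfolding subtopology_subtopology
    by (rule continuous_map_from_subtopology_mono) (auto simp: A'_def)
  moreover have "\<forall>a\<in>A'. FY a = f (FX a)" by (simp add: A'_def)
  ultimately obtain G where G: "continuous_map ?Z X G" "\<forall>a\<in>A'. G a = FX a"
      "\<forall>z\<in>topspace ?Z. FY z = f (G z)"
    using A' FY(1) unfolding soft_wrt_def by blast
  have "continuous_map Z ?Z e"
    using e_cont eY by (auto simp: continuous_map_in_subtopology DY_def)
  then have "continuous_map Z X (G \<circ> e)" using G(1) by (rule continuous_map_compose)
  moreover have "(G \<circ> e) a = \<Phi> a" if "a \<in> A" for a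
  proof -
    have aZ: "a \<in> topspace Z" using that closedin_subset[OF A] by auto
    have "FX (e a) = \<Phi> a" "FY (e a) = \<Psi> a" using eX[OF that] eY[OF aZ] FX(2) FY(2) by auto
    moreover from this have "e a \<in> A'"
      using eX[OF that] eY[OF aZ] eq that by (auto simp: A'_def DX_def DY_def)
    ultimately show ?thesis using G(2) by simp
  qed
  moreover have "\<Psi> a = f ((G \<circ> e) a)" if "a \<in> topspace Z" for a
  proof -
    have "e a \<in> topspace ?Z" using eY[OF that] by (auto simp: DY_def cube_space)
    then show ?thesis using G(3) FY(2)[OF eY[OF that]] by auto
  qed
  ultimately show "\<exists>G. continuous_map Z X G \<and> (\<forall>a\<in>A. G a = \<Phi> a) \<and> (\<forall>z\<in>topspace Z. \<Psi> z = f (G z))"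
    by blast
qed

end

theory Submission
  imports Defs
begin

text \<open>
  Write \<open>\<delta>\<^sub>x \<oplus> \<delta>\<^sub>y\<close> for the measure \<open>\<phi> \<mapsto> max (\<phi> x) (\<phi> y)\<close>. Softness is tested on one lifting problem,
  parametrized by triples \<open>(x, y, u)\<close> of points of \<open>X\<close>, or rather by a zero-dimensional compactum
  \<open>Z\<close> that is mapped onto \<open>X \<times> X \<times> X\<close>. Over \<open>(x, y, u)\<close> the measure \<open>\<delta>\<^sub>u \<oplus> \<delta>\<^sub>y\<close> is to be
  lifted through the barycenter map, and on the closed set where \<open>x = y\<close> or \<open>x = u\<close> the lift is
  prescribed to be \<open>\<delta>\<^bsub>\<delta>\<^sub>x \<oplus> \<delta>\<^sub>y\<^esub> \<oplus> \<delta>\<^bsub>\<delta>\<^sub>u \<oplus> \<delta>\<^sub>y\<^esub>\<close>. Let \<open>G\<close> be a lift that extends this prescription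
  (\<open>soft_selection\<close>).

  For \<open>x = y\<close> the Dirac measure \<open>\<delta>\<^sub>y\<close> occurs in \<open>G\<close> with full weight \<open>0\<close>. This is recorded by the
  functional \<open>\<nu> \<mapsto> - \<nu> f\<close>, called \<open>ntilde X f\<close> below: on it \<open>G\<close> takes the value \<open>- f y\<close>, although
  for \<open>f y < f u\<close> a lift of \<open>\<delta>\<^sub>u \<oplus> \<delta>\<^sub>y\<close> could take the smaller value \<open>- f u\<close>. By compactness, the value \<open>- f y\<close>
  persists for \<open>x \<noteq> y\<close> as long as \<open>x\<close> and \<open>y\<close> agree on a suitable countable set of functions
  (\<open>countable_control\<close>). For \<open>u = x \<noteq> y\<close>, on the contrary, \<open>G\<close> is the Dirac measure at
  \<open>\<delta>\<^sub>x \<oplus> \<delta>\<^sub>y\<close>, and \<open>\<delta>\<^sub>y\<close> does not occur at all.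

  Let a countable family \<open>\<F>\<close> of functions be closed under passing from \<open>f\<close> to the countable set
  that controls it, and suppose that \<open>x \<noteq> y\<close> have the same values under all of \<open>\<F>\<close>. For every \<open>u\<close>
  outside the common fibre of \<open>x\<close> and \<open>y\<close> the lift over \<open>(x, y, u)\<close> is of the first kind. If such
  points \<open>u\<close> accumulated at \<open>x\<close>, continuity of \<open>G\<close> would contradict the second kind. So every fibre
  of \<open>\<F>\<close> with more than one point is open (\<open>open_nontrivial_fibres\<close>).

  An open fibre is cut out by finitely many inequalities \<open>p < f < q\<close> with \<open>f\<close> in \<open>\<F>\<close> and rational
  \<open>p\<close>, \<open>q\<close> (\<open>open_fibre_is_fun_box\<close>). There are only countably many such systems of inequalities, so
  \<open>\<F>\<close> may also be assumed to contain, for each of them, a function that is not constant on its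
  solution set unless this set has at most one point. Then no fibre of \<open>\<F>\<close> has more than one point:
  the countable family \<open>\<F>\<close> separates the points of \<open>X\<close>, and \<open>X\<close> is metrizable.
\<close>

section \<open>Countably many functions on a compactum\<close>

lemma restrict_in_CX:
  assumes "compact_space X" "continuous_map X euclideanreal g"
  shows "restrict g (topspace X) \<in> CX X"
proof -
  have "continuous_map X euclideanreal (restrict g (topspace X))"
    using assms(2) by (rule continuous_map_eq) simp
  then show ?thesis using assms(1) by (simp add: mem_CX_iff)
qed

lemma CX_continuous: "compact_space X \<Longrightarrow> \<phi> \<in> CX X \<Longrightarrow> continuous_map X euclideanreal \<phi>"
  by (simp add: mem_CX_iff)

lemma CX_bounded:
  assumes "compact_space X" "\<phi> \<in> CX X"
  obtains B where "\<And>x. x \<in> topspace X \<Longrightarrow> \<bar>\<phi> x\<bar> \<le> B"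
proof -
  have "compact (\<phi> ` topspace X)"
    using image_compactin[of X "topspace X" euclideanreal \<phi>] assms
    by (simp add: compact_space_def CX_continuous)
  then show ?thesis using that compact_imp_bounded by (force simp: bounded_iff)
qed

lemma CX_separates_points:
  assumes "compact_space X" "Hausdorff_space X" "x \<in> topspace X" "y \<in> topspace X" "x \<noteq> y"
  obtains h where "h \<in> CX X" "h y < h x"
proof -
  have "normal_space X"
    using assms by (simp add: compact_Hausdorff_or_regular_imp_normal_space)
  moreover have "closedin X {x}" "closedin X {y}" "disjnt {x} {y}"
    using assms by (auto simp: closedin_Hausdorff_singleton)
  ultimately obtain f where "continuous_map X euclideanreal f" "f ` {x} \<subseteq> {1}" "f ` {y} \<subseteq> {0::real}"
    by (rule Urysohn_lemma_alt)
  then show ?thesis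
    using that[OF restrict_in_CX[OF assms(1), of f]] assms(3,4) by auto
qed

lemma metrizable_if_countable_separating:
  assumes X: "compact_space X" and \<F>: "countable \<F>" "\<F> \<subseteq> CX X"
    and sep: "\<And>x y. x \<in> topspace X \<Longrightarrow> y \<in> topspace X \<Longrightarrow> (\<And>f. f \<in> \<F> \<Longrightarrow> f x = f y) \<Longrightarrow> x = y"
  shows "metrizable_space X"
proof -
  let ?P = "product_topology (\<lambda>_. euclideanreal) \<F>"
  let ?e = "\<lambda>x. \<lambda>f\<in>\<F>. f x"
  have P: "metrizable_space ?P" "Hausdorff_space ?P"
    using \<F>(1) unfolding metrizable_space_product_topology
    by (auto simp: metrizable_space_euclidean Hausdorff_space_product_topology)
  have cont: "continuous_map X ?P ?e"
    using \<F>(2) CX_continuous[OF X] by (auto simp: continuous_map_componentwise)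
  have "inj_on ?e (topspace X)"
    using sep unfolding inj_on_def by (metis (no_types, lifting) restrict_apply')
  then have "X homeomorphic_space subtopology ?P (?e ` topspace X)"
    using cont continuous_imp_closed_map[OF cont X P(2)]
    by (intro embedding_map_imp_homeomorphic_space injective_closed_imp_embedding_map)
  then show ?thesis
    using P(1) metrizable_space_subtopology homeomorphic_metrizable_space by blast
qed

text \<open>On the compact set where \<open>\<bar>e\<bar>\<close> is at least \<open>1 / (n + 1)\<close>, the points \<open>a z\<close> and \<open>b z\<close> differ, and
  by compactness finitely many functions separate them there.\<close>

lemma countable_control:
  fixes X :: "'a topology"
  assumes Z: "compact_space Z" and X: "compact_space X" "Hausdorff_space X"
    and a: "continuous_map Z X a" and b: "continuous_map Z X b"
    and e: "continuous_map Z euclideanreal e"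
    and zero: "\<And>z. z \<in> topspace Z \<Longrightarrow> a z = b z \<Longrightarrow> e z = 0"
  shows "\<exists>\<H>. countable \<H> \<and> \<H> \<subseteq> CX X \<and>
             (\<forall>z\<in>topspace Z. (\<forall>h\<in>\<H>. h (a z) = h (b z)) \<longrightarrow> e z = 0)"
proof -
  have fin: "\<exists>\<H>. finite \<H> \<and> \<H> \<subseteq> CX X \<and>
      (\<forall>z\<in>topspace Z. (\<forall>h\<in>\<H>. h (a z) = h (b z)) \<longrightarrow> \<bar>e z\<bar> < 1 / Suc n)" for n
  proof -
    define U where "U h = {z \<in> topspace Z. h (a z) - h (b z) \<in> - {0}}" for h :: "'a \<Rightarrow> real"
    define V where "V = {z \<in> topspace Z. \<bar>e z\<bar> \<in> {..<1 / Suc n}}"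
    have U: "openin Z (U h)" if "h \<in> CX X" for h
    proof -
      have "continuous_map Z euclideanreal (\<lambda>z. h (a z) - h (b z))"
        using continuous_map_compose[OF a CX_continuous[OF X(1) that]]
          continuous_map_compose[OF b CX_continuous[OF X(1) that]]
        by (intro continuous_map_diff) (simp_all add: o_def)
      then show ?thesis
        unfolding U_def by (rule openin_continuous_map_preimage) (simp add: open_Compl)
    qed
    have V: "openin Z V"
      unfolding V_def using e
      by (intro openin_continuous_map_preimage[where Y = euclideanreal])
        (auto intro: continuous_map_real_abs)
    have cover: "topspace Z \<subseteq> \<Union>(insert V (U ` CX X))"
    proof
      fix z assume z: "z \<in> topspace Z"
      show "z \<in> \<Union>(insert V (U ` CX X))"
      proof (cases "a z = b z")
        case True
        then have "z \<in> V" using z zero by (simp add: V_def)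
        then show ?thesis by blast
      next
        case False
        moreover have "a z \<in> topspace X" "b z \<in> topspace X"
          using z a b by (auto dest: continuous_map_image_subset_topspace)
        ultimately obtain h where "h \<in> CX X" "h (b z) < h (a z)"
          using CX_separates_points[OF X] by metis
        moreover from this have "z \<in> U h" using z by (simp add: U_def)
        ultimately show ?thesis by blast
      qed
    qed
    have op: "openin Z W" if "W \<in> insert V (U ` CX X)" for W using U V that by blast
    have "\<exists>\<W>. finite \<W> \<and> \<W> \<subseteq> insert V (U ` CX X) \<and> topspace Z \<subseteq> \<Union>\<W>"
      by (rule compactinD[OF Z[unfolded compact_space_def] _ cover]) (rule op)
    then obtain \<W> where \<W>: "finite \<W>" "\<W> \<subseteq> insert V (U ` CX X)" "topspace Z \<subseteq> \<Union>\<W>"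
      by (elim exE conjE)
    have "finite (\<W> - {V})" "\<W> - {V} \<subseteq> U ` CX X" using \<W>(1,2) by auto
    from finite_subset_image[OF this]
    obtain \<H> where \<H>: "\<H> \<subseteq> CX X" "finite \<H>" "\<W> - {V} = U ` \<H>"
      by (elim exE conjE bexE) (rule that)
    have "z \<in> V \<or> (\<exists>h\<in>\<H>. z \<in> U h)" if z: "z \<in> topspace Z" for z
    proof -
      obtain W where W: "W \<in> \<W>" "z \<in> W" using \<W>(3) z by auto
      have "W \<in> U ` \<H>" if "W \<noteq> V" using W(1) that \<H>(3) by auto
      then show ?thesis using W(2) by auto
    qed
    then show ?thesis using \<H>(1,2) by (intro exI[of _ \<H>]) (auto simp: U_def V_def)
  qed
  then obtain \<H> where \<H>: "\<And>n. finite (\<H> n)" "\<And>n. \<H> n \<subseteq> CX X"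
    "\<And>n z. z \<in> topspace Z \<Longrightarrow> (\<And>h. h \<in> \<H> n \<Longrightarrow> h (a z) = h (b z)) \<Longrightarrow> \<bar>e z\<bar> < 1 / Suc n"
    by metis
  have "e z = 0" if "z \<in> topspace Z" "\<forall>h\<in>(\<Union>n. \<H> n). h (a z) = h (b z)" for z
  proof (rule ccontr)
    assume "e z \<noteq> 0"
    then obtain n where "1 / Suc n < \<bar>e z\<bar>"
      by (metis nat_approx_posE zero_less_abs_iff)
    then show False using \<H>(3)[OF that(1), of n] that(2) by force
  qed
  moreover have "countable (\<Union>n. \<H> n)" using \<H>(1) by (simp add: countable_finite)
  ultimately show ?thesis using \<H>(2) by (intro exI[of _ "\<Union>n. \<H> n"]) blast
qed

definition fun_box :: "'a topology \<Rightarrow> (('a \<Rightarrow> real) \<times> real \<times> real) set \<Rightarrow> 'a set" where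
  "fun_box X t = {u \<in> topspace X. \<forall>(f, p, q)\<in>t. p < f u \<and> f u < q}"

text \<open>The complement of the fibre is compact and covered by the open sets \<open>f\<^sup>-\<^sup>1(\<real> - [p, q])\<close> with rational
  \<open>p < f x < q\<close>. Consequently a countable family has only countably many open fibres.\<close>

lemma open_fibre_is_fun_box:
  assumes X: "compact_space X" and \<F>: "\<F> \<subseteq> CX X"
    and op: "openin X {u \<in> topspace X. \<forall>f\<in>\<F>. f u = f x}"
  shows "\<exists>t. finite t \<and> t \<subseteq> \<F> \<times> \<rat> \<times> \<rat> \<and> fun_box X t = {u \<in> topspace X. \<forall>f\<in>\<F>. f u = f x}"
proof -
  define E where "E = {u \<in> topspace X. \<forall>f\<in>\<F>. f u = f x}"
  have E_const: "f u = f x" if "f \<in> \<F>" "u \<in> E" for f u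
    using that unfolding E_def by blast
  define I where "I = {(f, p, q). f \<in> \<F> \<and> p \<in> \<rat> \<and> q \<in> \<rat> \<and> p < f x \<and> f x < q}"
  define outside where "outside = (\<lambda>(f, p, q). {u \<in> topspace X. f u \<in> - {p..q::real}})"
  have op: "openin X W" if W: "W \<in> outside ` I" for W
  proof -
    obtain f p q where i: "W = outside (f, p, q)" "f \<in> \<F>" using W by (auto simp: I_def)
    have "continuous_map X euclideanreal f"
      using i(2) \<F> CX_continuous[OF X] by auto
    then show ?thesis
      unfolding i(1) outside_def prod.case
      by (rule openin_continuous_map_preimage) (simp add: open_Compl)
  qed
  have cover: "topspace X - E \<subseteq> \<Union>(outside ` I)"
  proof
    fix u assume u: "u \<in> topspace X - E"
    then obtain f where f: "f \<in> \<F>" "f u \<noteq> f x" by (auto simp: E_def)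
    have "\<exists>p\<in>\<rat>. (if f u < f x then f u else f x - 1) < p \<and> p < f x"
      by (rule Rats_dense_in_real) simp
    then obtain p where p: "p \<in> \<rat>" "(if f u < f x then f u else f x - 1) < p" "p < f x"
      by blast
    have "\<exists>q\<in>\<rat>. f x < q \<and> q < (if f x < f u then f u else f x + 1)"
      by (rule Rats_dense_in_real) simp
    then obtain q where q: "q \<in> \<rat>" "f x < q" "q < (if f x < f u then f u else f x + 1)"
      by blast
    have "(f, p, q) \<in> I" using f p q by (simp add: I_def)
    moreover have "u \<in> outside (f, p, q)"
      using u f p q by (auto simp: outside_def split: if_splits)
    ultimately show "u \<in> \<Union>(outside ` I)" by blast
  qed
  have comp: "compactin X (topspace X - E)"
    using assms(3) X unfolding E_def by (intro closedin_compact_space) auto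
  have "\<exists>\<W>. finite \<W> \<and> \<W> \<subseteq> outside ` I \<and> topspace X - E \<subseteq> \<Union>\<W>"
    by (rule compactinD[OF comp _ cover]) (rule op)
  then obtain \<W> where \<W>: "finite \<W>" "\<W> \<subseteq> outside ` I" "topspace X - E \<subseteq> \<Union>\<W>"
    by (elim exE conjE)
  from finite_subset_image[OF \<W>(1,2)]
  obtain t where t: "t \<subseteq> I" "finite t" "\<W> = outside ` t"
    by (elim exE conjE bexE) (rule that)
  have tI: "f \<in> \<F> \<and> p \<in> \<rat> \<and> q \<in> \<rat> \<and> p < f x \<and> f x < q" if "(f, p, q) \<in> t" for f p q
    using subsetD[OF t(1) that] by (simp add: I_def)
  have "fun_box X t = E"
  proof
    show "fun_box X t \<subseteq> E"
    proof
      fix u assume u: "u \<in> fun_box X t"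
      then have "u \<notin> outside i" if "i \<in> t" for i
        using that by (auto simp: fun_box_def outside_def)
      then show "u \<in> E" using \<W>(3) t(3) u by (auto simp: fun_box_def)
    qed
    show "E \<subseteq> fun_box X t"
    proof
      fix u assume u: "u \<in> E"
      have "p < f u \<and> f u < q" if "(f, p, q) \<in> t" for f p q
      proof -
        have "f u = f x" using tI[OF that] u by (intro E_const) auto
        then show ?thesis using tI[OF that] by simp
      qed
      then show "u \<in> fun_box X t" using u by (auto simp: fun_box_def E_def)
    qed
  qed
  moreover have "t \<subseteq> \<F> \<times> \<rat> \<times> \<rat>" using tI by auto
  ultimately show ?thesis using t(2) unfolding E_def by blast
qed

text \<open>The closure process stops after \<open>\<omega>\<close> steps because \<open>T\<close> is only applied to finite sets.\<close>

lemma countable_closed_subset: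
  assumes T: "\<forall>s. finite s \<and> s \<subseteq> A \<longrightarrow> countable (T s) \<and> T s \<subseteq> A"
  obtains S where "countable S" "S \<subseteq> A" "\<And>s. finite s \<Longrightarrow> s \<subseteq> S \<Longrightarrow> T s \<subseteq> S"
proof -
  define S where "S = rec_nat {} (\<lambda>_ C. C \<union> (\<Union>s\<in>Fpow C. T s))"
  have S: "S 0 = {}" "S (Suc n) = S n \<union> (\<Union>s\<in>Fpow (S n). T s)" for n
    by (simp_all add: S_def)
  have inv: "countable (S n) \<and> S n \<subseteq> A" for n
  proof (induction n)
    case (Suc n)
    have "countable (T s) \<and> T s \<subseteq> A" if "s \<in> Fpow (S n)" for s
      using T that Suc by (auto simp: Fpow_def)
    then show ?case using Suc by (auto simp: S countable_Fpow)
  qed (simp add: S)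
  have "mono S" by (rule mono_iff_le_Suc[THEN iffD2]) (simp add: S)
  have fin: "\<exists>n. s \<subseteq> S n" if "finite s" "s \<subseteq> (\<Union>n. S n)" for s
    using that
  proof (induction s)
    case (insert x s)
    then obtain m n where "x \<in> S m" "s \<subseteq> S n" by auto
    then have "insert x s \<subseteq> S (max m n)"
      using monoD[OF \<open>mono S\<close>, of m "max m n"] monoD[OF \<open>mono S\<close>, of n "max m n"] by auto
    then show ?case by blast
  qed simp
  show thesis
  proof
    show "countable (\<Union>n. S n)" using inv by simp
    show "(\<Union>n. S n) \<subseteq> A" using inv by blast
    show "T s \<subseteq> (\<Union>n. S n)" if s: "finite s" "s \<subseteq> (\<Union>n. S n)" for s
    proof -
      obtain n where "s \<subseteq> S n" using fin[OF s] by blast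
      then have "T s \<subseteq> S (Suc n)" using s(1) by (auto simp: S Fpow_def)
      then show ?thesis by blast
    qed
  qed
qed

section \<open>Idempotent measures\<close>

lemma idempotent_measure_le_max:
  assumes X: "compact_space X" and \<mu>: "idempotent_measure X \<mu>"
    and CX: "\<phi> \<in> CX X" "\<psi> \<in> CX X" "\<theta> \<in> CX X"
    and le: "\<And>x. x \<in> topspace X \<Longrightarrow> \<phi> x \<le> max (c + \<psi> x) (d + \<theta> x)"
  shows "\<mu> \<phi> \<le> max (c + \<mu> \<psi>) (d + \<mu> \<theta>)"
proof -
  let ?m = "oplus X (odot X c \<psi>) (odot X d \<theta>)"
  have m: "odot X c \<psi> \<in> CX X" "odot X d \<theta> \<in> CX X" "?m \<in> CX X"
    using CX by (simp_all add: CX_closed[OF X])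
  have "oplus X \<phi> ?m = ?m"
    using le by (auto simp: oplus_def odot_def max_absorb2)
  then have "max (\<mu> \<phi>) (\<mu> ?m) = \<mu> ?m"
    using \<mu> CX(1) m(3) unfolding idempotent_measure_def by metis
  moreover have "\<mu> ?m = max (c + \<mu> \<psi>) (d + \<mu> \<theta>)"
    using \<mu> CX m unfolding idempotent_measure_def by simp
  ultimately show ?thesis by linarith
qed

text \<open>The measure \<open>\<delta>\<^sub>x \<oplus> \<delta>\<^sub>y\<close>. Taking \<open>y = x\<close> gives the Dirac measure \<open>\<delta>\<^sub>x\<close>, so that one formula serves
  on both parts of the closed set on which the lift is prescribed.\<close>

definition dirac2 :: "'a topology \<Rightarrow> 'a \<Rightarrow> 'a \<Rightarrow> ('a \<Rightarrow> real) \<Rightarrow> real" where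
  "dirac2 X x y = (\<lambda>\<phi>\<in>CX X. max (\<phi> x) (\<phi> y))"

lemma dirac2_in_IX:
  assumes "compact_space X" "x \<in> topspace X" "y \<in> topspace X"
  shows "dirac2 X x y \<in> topspace (IX X)"
  unfolding topspace_IX mem_Collect_eq idempotent_measure_def
proof (intro conjI ballI allI)
  show "dirac2 X x y \<in> extensional (CX X)" by (simp add: dirac2_def)
  show "dirac2 X x y (cst X 1) = 1"
    using assms CX_closed(1)[OF assms(1)] by (simp add: dirac2_def cst_def)
  show "dirac2 X x y (odot X l \<phi>) = l + dirac2 X x y \<phi>" if "\<phi> \<in> CX X" for l \<phi>
    using CX_closed(2)[OF assms(1) that, of l] that assms
    by (simp add: dirac2_def) (simp add: odot_def)
  show "dirac2 X x y (oplus X \<psi> \<phi>) = max (dirac2 X x y \<psi>) (dirac2 X x y \<phi>)"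
    if "\<psi> \<in> CX X" "\<phi> \<in> CX X" for \<psi> \<phi>
    using CX_closed(3)[OF assms(1) that] that assms
    by (simp add: dirac2_def) (simp add: oplus_def)
qed

lemma continuous_map_dirac2:
  assumes X: "compact_space X" and a: "continuous_map Z X a" and b: "continuous_map Z X b"
  shows "continuous_map Z (IX X) (\<lambda>z. dirac2 X (a z) (b z))"
proof -
  have ab: "a z \<in> topspace X" "b z \<in> topspace X" if "z \<in> topspace Z" for z
    using that a b by (auto dest: continuous_map_image_subset_topspace)
  have "continuous_map Z euclideanreal (\<lambda>z. dirac2 X (a z) (b z) \<phi>)" if "\<phi> \<in> CX X" for \<phi>
    using continuous_map_compose[OF a CX_continuous[OF X that]]
      continuous_map_compose[OF b CX_continuous[OF X that]] that
    by (simp add: dirac2_def continuous_map_real_max o_def)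
  moreover have "dirac2 X x y \<in> extensional (CX X)" for x y by (simp add: dirac2_def)
  moreover have "idempotent_measure X (dirac2 X (a z) (b z))" if "z \<in> topspace Z" for z
    using dirac2_in_IX[OF X ab[OF that]] by (simp add: topspace_IX)
  ultimately show ?thesis
    by (auto simp: IX_def continuous_map_in_subtopology continuous_map_componentwise)
qed

lemma idem_barycenter_dirac2:
  assumes X: "compact_space X" and \<nu>: "\<nu> \<in> topspace (IX X)" "\<nu>' \<in> topspace (IX X)"
  shows "idem_barycenter X (dirac2 (IX X) \<nu> \<nu>') = (\<lambda>\<phi>\<in>CX X. max (\<nu> \<phi>) (\<nu>' \<phi>))"
proof -
  have "dirac2 (IX X) \<nu> \<nu>' (tilde X \<phi>) = max (\<nu> \<phi>) (\<nu>' \<phi>)" if "\<phi> \<in> CX X" for \<phi>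
    using tilde_in_CX[OF X that] \<nu> by (simp add: dirac2_def tilde_def)
  then show ?thesis by (auto simp: idem_barycenter_def)
qed

text \<open>The negative of \<open>tilde X \<phi>\<close>. The barycenter of \<open>M\<close> determines \<open>M\<close> on the functions \<open>tilde X \<phi>\<close>;
  their negatives can tell apart different \<open>M\<close> with the same barycenter.\<close>

definition ntilde :: "'a topology \<Rightarrow> ('a \<Rightarrow> real) \<Rightarrow> (('a \<Rightarrow> real) \<Rightarrow> real) \<Rightarrow> real" where
  "ntilde X \<phi> = (\<lambda>\<nu>\<in>topspace (IX X). - \<nu> \<phi>)"

lemma ntilde_in_CX:
  assumes X: "compact_space X" and \<phi>: "\<phi> \<in> CX X"
  shows "ntilde X \<phi> \<in> CX (IX X)"
proof -
  note IX = IX_compactum(1)[OF X]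
  have "continuous_map (IX X) euclideanreal (\<lambda>\<nu>. - tilde X \<phi> \<nu>)"
    using CX_continuous[OF IX tilde_in_CX[OF X \<phi>]] by (simp add: continuous_map_minus)
  from restrict_in_CX[OF IX this] show ?thesis
    by (rule back_subst[of "\<lambda>f. f \<in> CX (IX X)"]) (auto simp: ntilde_def tilde_def)
qed

lemma continuous_map_IX_eval:
  assumes "\<phi> \<in> CX X" "continuous_map Z (IX X) G"
  shows "continuous_map Z euclideanreal (\<lambda>z. G z \<phi>)"
proof -
  have "continuous_map (IX X) euclideanreal (\<lambda>\<nu>. \<nu> \<phi>)"
    using continuous_map_product_projection[OF assms(1), of "\<lambda>_. euclideanreal"]
    unfolding IX_def by (rule continuous_map_from_subtopology)
  from continuous_map_compose[OF assms(2) this] show ?thesis by (simp add: o_def)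
qed

text \<open>A measure \<open>M\<close> with barycenter \<open>\<delta>\<^sub>u \<oplus> \<delta>\<^sub>y\<close> lives on measures \<open>\<nu>\<close> that are supported by \<open>u\<close> and \<open>y\<close>,
  and for those \<open>\<nu> h \<le> \<nu> f\<close>. The proof replaces supports by a penalty function \<open>\<psi>\<close>: it is very
  negative at \<open>u\<close> and \<open>y\<close> but at least \<open>h\<close> wherever \<open>h\<close> exceeds \<open>f + e\<close>. A measure \<open>\<nu>\<close> that violates
  \<open>\<nu> h \<le> \<nu> f + e\<close> must have \<open>\<nu> h \<le> \<nu> \<psi>\<close>, while \<open>M (tilde X \<psi>) = max (\<psi> u) (\<psi> y)\<close> is too small for
  such measures to matter.\<close>

lemma ntilde_antimono_on_barycenter:
  assumes X: "compact_space X" and M: "idempotent_measure (IX X) M"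
    and bary: "idem_barycenter X M = dirac2 X u y" and uy: "u \<in> topspace X" "y \<in> topspace X"
    and fh: "f \<in> CX X" "h \<in> CX X" and le: "h u \<le> f u" "h y \<le> f y"
  shows "M (ntilde X f) \<le> M (ntilde X h)"
proof (rule field_le_epsilon)
  fix e :: real assume e: "0 < e"
  note IX = IX_compactum(1)[OF X]
  obtain B1 where B1: "\<And>x. x \<in> topspace X \<Longrightarrow> \<bar>f x\<bar> \<le> B1" using CX_bounded[OF X fh(1)] by blast
  obtain B2 where B2: "\<And>x. x \<in> topspace X \<Longrightarrow> \<bar>h x\<bar> \<le> B2" using CX_bounded[OF X fh(2)] by blast
  \<comment> \<open>\<open>B1 + B2\<close> compensates the loss in passing from \<open>\<nu> h \<le> \<nu> \<psi>\<close> to \<open>- \<nu> f \<le> B1 + B2 + \<nu> \<psi>\<close>.\<close>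
  define m where "m = M (ntilde X f) - B1 - B2 - 1"
  define L where "L = max 0 ((B2 - m) / e)"
  have L: "0 \<le> L" "B2 - L * e \<le> m"
    using e by (auto simp: L_def max_def field_simps)
  define \<psi> where "\<psi> = (\<lambda>x\<in>topspace X. h x + L * min 0 (h x - f x - e))"
  have \<psi>: "\<psi> \<in> CX X"
    unfolding \<psi>_def using CX_continuous[OF X fh(1)] CX_continuous[OF X fh(2)]
    by (intro restrict_in_CX[OF X] continuous_map_add continuous_map_real_mult
        continuous_map_real_min continuous_map_diff) auto
  have low: "\<psi> x \<le> m" if x: "x \<in> topspace X" "h x \<le> f x" for x
  proof -
    have "L * min 0 (h x - f x - e) \<le> L * (- e)"
      using x(2) L(1) by (intro mult_left_mono) auto
    then show ?thesis using B2[OF x(1)] L(2) x(1) by (simp add: \<psi>_def)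
  qed
  have "ntilde X f \<nu> \<le> max (e + ntilde X h \<nu>) ((B1 + B2) + tilde X \<psi> \<nu>)"
    if \<nu>: "\<nu> \<in> topspace (IX X)" for \<nu>
  proof -
    have im: "idempotent_measure X \<nu>" using \<nu> by (simp add: topspace_IX)
    have "h x \<le> max (e + f x) (0 + \<psi> x)" if "x \<in> topspace X" for x
      using that by (auto simp: \<psi>_def max_def min_def)
    from idempotent_measure_le_max[OF X im fh(2,1) \<psi> this]
    have "\<nu> h \<le> max (e + \<nu> f) (0 + \<nu> \<psi>)" .
    moreover have "\<bar>\<nu> f\<bar> \<le> B1" "\<bar>\<nu> h\<bar> \<le> B2"
      using idempotent_measure_bound[OF X im] fh B1 B2 by blast+
    ultimately show ?thesis using \<nu> by (auto simp: ntilde_def tilde_def)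
  qed
  from idempotent_measure_le_max[OF IX M ntilde_in_CX[OF X fh(1)] ntilde_in_CX[OF X fh(2)]
      tilde_in_CX[OF X \<psi>] this]
  have "M (ntilde X f) \<le> max (e + M (ntilde X h)) ((B1 + B2) + M (tilde X \<psi>))" .
  moreover have "M (tilde X \<psi>) = max (\<psi> u) (\<psi> y)"
    using fun_cong[OF bary, of \<psi>] \<psi> by (simp add: idem_barycenter_def dirac2_def)
  then have "M (tilde X \<psi>) \<le> m" using low uy le by simp
  ultimately show "M (ntilde X f) \<le> M (ntilde X h) + e" by (auto simp: m_def)
qed

section \<open>The test problem for softness\<close>

text \<open>The cover is the space of codes: every point of \<open>Y\<close> has a code, and the decoding map is
  continuous.\<close>

lemma zero_dimensional_compact_cover:
  fixes Y :: "'b topology"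
  assumes Y: "compact_space Y" "Hausdorff_space Y"
  obtains Z :: "('b set \<times> 'b set \<Rightarrow> bool) topology" and p
  where "compact_space Z" "zero_dimensional Z" "paracompact_space Z"
    "continuous_map Z Y p" "p ` topspace Z = topspace Y"
proof -
  define D where "D = {z. \<exists>x. codes Y (\<lambda>i. i) z x}"
  have cl: "closedin cube D" using decode(1)[OF Y] by (simp add: D_def)
  obtain F where F: "continuous_map (subtopology cube D) Y F"
    "\<And>z x. codes Y (\<lambda>i. i) z x \<Longrightarrow> F z = x"
    using decode(2)[OF Y, of "\<lambda>i. i"] unfolding D_def by blast
  have code: "codes Y (\<lambda>i. i) (\<lambda>(U, V). x \<in> U) x" if "x \<in> topspace Y" for x
    unfolding codes_def
  proof (intro conjI allI impI that)
    fix U V assume "openin Y U \<and> openin Y V \<and> U \<union> V = topspace Y"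
    then show "x \<in> Y closure_of (if case (U, V) of (U, V) \<Rightarrow> x \<in> U then U else V)"
      using that closure_of_subset[of U Y] closure_of_subset[of V Y] openin_subset[of Y] by auto
  qed
  show thesis
  proof
    show "compact_space (subtopology cube D)"
      using cl cube_space(1) closedin_compact_space compact_space_subtopology by blast
    show "zero_dimensional (subtopology cube D)" "paracompact_space (subtopology cube D)"
      using zero_dimensional_closed_cube[OF cl] .
    show "continuous_map (subtopology cube D) Y F" by (rule F(1))
    show "F ` topspace (subtopology cube D) = topspace Y"
    proof
      show "F ` topspace (subtopology cube D) \<subseteq> topspace Y"
        using F(1) by (rule continuous_map_image_subset_topspace)
      show "topspace Y \<subseteq> F ` topspace (subtopology cube D)"
      proof
        fix x assume "x \<in> topspace Y"
        from F(2)[OF code[OF this]] code[OF this]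
        show "x \<in> F ` topspace (subtopology cube D)"
          by (auto simp: D_def cube_space intro!: image_eqI[of x F])
      qed
    qed
  qed
qed

text \<open>The formula \<open>\<delta>\<^bsub>\<delta>\<^sub>x \<oplus> \<delta>\<^sub>y\<^esub> \<oplus> \<delta>\<^bsub>\<delta>\<^sub>u \<oplus> \<delta>\<^sub>y\<^esub>\<close> has barycenter \<open>\<delta>\<^sub>x \<oplus> \<delta>\<^sub>u \<oplus> \<delta>\<^sub>y\<close>, which is the required
  \<open>\<delta>\<^sub>u \<oplus> \<delta>\<^sub>y\<close> exactly because \<open>x\<close> is one of \<open>y\<close> and \<open>u\<close> on the closed set where it is prescribed. It
  merges two incompatible lifts: \<open>\<delta>\<^bsub>\<delta>\<^sub>y\<^esub> \<oplus> \<delta>\<^bsub>\<delta>\<^sub>u \<oplus> \<delta>\<^sub>y\<^esub>\<close> for \<open>x = y\<close> and \<open>\<delta>\<^bsub>\<delta>\<^sub>x \<oplus> \<delta>\<^sub>y\<^esub>\<close> for \<open>x = u\<close>.\<close>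

lemma soft_selection:
  fixes X :: "'a topology"
  assumes X: "compact_space X" "Hausdorff_space X"
    and soft: "zero_soft (IX (IX X)) (IX X) (idem_barycenter X)"
  obtains Z :: "(('a \<times> 'a \<times> 'a) set \<times> ('a \<times> 'a \<times> 'a) set \<Rightarrow> bool) topology" and a b c G
  where "compact_space Z" "continuous_map Z X a" "continuous_map Z X b" "continuous_map Z X c"
    "\<And>x y u. x \<in> topspace X \<Longrightarrow> y \<in> topspace X \<Longrightarrow> u \<in> topspace X \<Longrightarrow>
       \<exists>z\<in>topspace Z. a z = x \<and> b z = y \<and> c z = u"
    "continuous_map Z (IX (IX X)) G"
    "\<And>z. z \<in> topspace Z \<Longrightarrow> idem_barycenter X (G z) = dirac2 X (c z) (b z)"
    "\<And>z. z \<in> topspace Z \<Longrightarrow> a z = b z \<or> a z = c z \<Longrightarrow>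
       G z = dirac2 (IX X) (dirac2 X (a z) (b z)) (dirac2 X (c z) (b z))"
proof -
  note IX = IX_compactum[OF X(1)]
  let ?X3 = "prod_topology X (prod_topology X X)"
  have X3: "compact_space ?X3" "Hausdorff_space ?X3"
    using X by (simp_all add: compact_space_prod_topology Hausdorff_space_prod_topology)
  obtain Z :: "(('a \<times> 'a \<times> 'a) set \<times> ('a \<times> 'a \<times> 'a) set \<Rightarrow> bool) topology" and p
    where Z: "compact_space Z" "zero_dimensional Z" "paracompact_space Z"
      and p: "continuous_map Z ?X3 p" "p ` topspace Z = topspace ?X3"
    by (rule zero_dimensional_compact_cover[OF X3]) (rule that)
  define a b c where "a = fst \<circ> p" and "b = fst \<circ> snd \<circ> p" and "c = snd \<circ> snd \<circ> p"
  have p2: "continuous_map Z (prod_topology X X) (snd \<circ> p)"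
    using p(1) by (rule continuous_map_compose) (rule continuous_map_snd)
  have abc: "continuous_map Z X a" "continuous_map Z X b" "continuous_map Z X c"
    unfolding a_def b_def c_def o_assoc[symmetric]
    by (rule continuous_map_compose[OF p(1) continuous_map_fst]
        continuous_map_compose[OF p2 continuous_map_fst]
        continuous_map_compose[OF p2 continuous_map_snd])+
  have in_X: "a z \<in> topspace X" "b z \<in> topspace X" "c z \<in> topspace X" if "z \<in> topspace Z" for z
    using that abc by (auto dest: continuous_map_image_subset_topspace)
  define A where "A = {z \<in> topspace Z. a z = b z} \<union> {z \<in> topspace Z. a z = c z}"
  let ?\<Phi> = "\<lambda>z. dirac2 (IX X) (dirac2 X (a z) (b z)) (dirac2 X (c z) (b z))"
  let ?\<Psi> = "\<lambda>z. dirac2 X (c z) (b z)"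
  have A: "closedin Z A"
    unfolding A_def using abc by (intro closedin_Un closedin_continuous_maps_eq[OF X(2)])
  have \<Psi>: "continuous_map Z (IX X) ?\<Psi>"
    using abc by (intro continuous_map_dirac2 X)
  have \<Phi>: "continuous_map (subtopology Z A) (IX (IX X)) ?\<Phi>"
    using abc by (intro continuous_map_from_subtopology continuous_map_dirac2 IX X)
  have eq: "?\<Psi> z = idem_barycenter X (?\<Phi> z)" if z: "z \<in> A" for z
  proof -
    have "z \<in> topspace Z" using z by (auto simp: A_def)
    then have "idem_barycenter X (?\<Phi> z) =
        (\<lambda>\<phi>\<in>CX X. max (dirac2 X (a z) (b z) \<phi>) (?\<Psi> z \<phi>))"
      using in_X X by (intro idem_barycenter_dirac2 dirac2_in_IX) auto
    also have "\<dots> = ?\<Psi> z"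
      using z by (auto simp: dirac2_def A_def)
    finally show ?thesis by simp
  qed
  have "soft_wrt Z (IX (IX X)) (IX X) (idem_barycenter X)"
    using zero_soft_imp_soft_wrt[OF IX_compactum[OF IX(1)] IX soft Z(2,3)] .
  from this[unfolded soft_wrt_def, rule_format, of A ?\<Phi> ?\<Psi>]
  have "\<exists>G. continuous_map Z (IX (IX X)) G \<and> (\<forall>z\<in>A. G z = ?\<Phi> z) \<and>
      (\<forall>z\<in>topspace Z. ?\<Psi> z = idem_barycenter X (G z))"
    using A \<Phi> \<Psi> eq by blast
  then obtain G where G: "continuous_map Z (IX (IX X)) G" "\<And>z. z \<in> A \<Longrightarrow> G z = ?\<Phi> z"
    "\<And>z. z \<in> topspace Z \<Longrightarrow> ?\<Psi> z = idem_barycenter X (G z)"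
    by blast
  show thesis
  proof
    show "\<exists>z\<in>topspace Z. a z = x \<and> b z = y \<and> c z = u"
      if "x \<in> topspace X" "y \<in> topspace X" "u \<in> topspace X" for x y u
    proof -
      have "(x, y, u) \<in> p ` topspace Z" using that by (simp add: p(2))
      then obtain z where "z \<in> topspace Z" "p z = (x, y, u)" by (metis imageE)
      then show ?thesis by (auto simp: a_def b_def c_def intro!: bexI[of _ z])
    qed
    show "G z = ?\<Phi> z" if "z \<in> topspace Z" "a z = b z \<or> a z = c z" for z
      using that by (intro G(2)) (auto simp: A_def)
    show "idem_barycenter X (G z) = ?\<Psi> z" if "z \<in> topspace Z" for z
      using G(3)[OF that] by simp
  qed (fact Z abc G)+
qed

text \<open>The set \<open>H f\<close> controls not only \<open>f\<close> but all its integer multiples. From \<open>G z (ntilde X f) = - f y\<close>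
  alone one cannot conclude that \<open>\<delta>\<^sub>y\<close> has full weight in the lift, since this value may also come
  from a measure \<open>\<alpha> \<odot> \<delta>\<^sub>u \<oplus> \<delta>\<^sub>y\<close> with \<open>\<alpha> + f u \<le> f y\<close>. Large multiples of \<open>f\<close>, positive or negative
  according to the sign of \<open>f u - f y\<close>, force \<open>\<alpha>\<close> to be arbitrarily negative.\<close>

lemma open_nontrivial_fibres:
  fixes X :: "'a topology"
  assumes X: "compact_space X" "Hausdorff_space X"
    and soft: "zero_soft (IX (IX X)) (IX X) (idem_barycenter X)"
  obtains H where "\<forall>f\<in>CX X. countable (H f) \<and> H f \<subseteq> CX X"
    "\<forall>\<F> x y. \<F> \<subseteq> CX X \<and> (\<forall>f\<in>\<F>. H f \<subseteq> \<F>) \<and>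
       x \<in> topspace X \<and> y \<in> topspace X \<and> x \<noteq> y \<and> (\<forall>f\<in>\<F>. f x = f y) \<longrightarrow>
       openin X {u \<in> topspace X. \<forall>f\<in>\<F>. f u = f x}"
proof -
  obtain Z :: "(('a \<times> 'a \<times> 'a) set \<times> ('a \<times> 'a \<times> 'a) set \<Rightarrow> bool) topology" and a b c G
    where Z: "compact_space Z"
      and abc: "continuous_map Z X a" "continuous_map Z X b" "continuous_map Z X c"
      and onto: "\<And>x y u. x \<in> topspace X \<Longrightarrow> y \<in> topspace X \<Longrightarrow> u \<in> topspace X \<Longrightarrow>
        \<exists>z\<in>topspace Z. a z = x \<and> b z = y \<and> c z = u"
      and G: "continuous_map Z (IX (IX X)) G"
      and bary: "\<And>z. z \<in> topspace Z \<Longrightarrow> idem_barycenter X (G z) = dirac2 X (c z) (b z)"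
      and G_A: "\<And>z. z \<in> topspace Z \<Longrightarrow> a z = b z \<or> a z = c z \<Longrightarrow>
        G z = dirac2 (IX X) (dirac2 X (a z) (b z)) (dirac2 X (c z) (b z))"
    by (rule soft_selection[OF assms]) (rule that)
  note nt = ntilde_in_CX[OF X(1)]
  have in_X: "a z \<in> topspace X" "b z \<in> topspace X" "c z \<in> topspace X" if "z \<in> topspace Z" for z
    using that abc by (auto dest: continuous_map_image_subset_topspace)
  have G_meas: "idempotent_measure (IX X) (G z)" if "z \<in> topspace Z" for z
    using continuous_map_image_subset_topspace[OF G] that by (auto simp: topspace_IX)
  have G_val: "G z (ntilde X f) = max (- max (f (a z)) (f (b z))) (- max (f (c z)) (f (b z)))"
    if "z \<in> topspace Z" "a z = b z \<or> a z = c z" "f \<in> CX X" for z f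
    unfolding G_A[OF that(1,2)] using that in_X[OF that(1)] nt[OF that(3)]
      dirac2_in_IX[OF X(1)]
    by (simp add: dirac2_def[of "IX X"] ntilde_def) (simp add: dirac2_def)
  have "\<exists>\<H>. countable \<H> \<and> \<H> \<subseteq> CX X \<and>
      (\<forall>z\<in>topspace Z. (\<forall>h\<in>\<H>. h (a z) = h (b z)) \<longrightarrow> G z (ntilde X f) + f (a z) = 0)"
    if f: "f \<in> CX X" for f
  proof (rule countable_control[OF Z X abc(1,2)])
    show "continuous_map Z euclideanreal (\<lambda>z. G z (ntilde X f) + f (a z))"
      using continuous_map_IX_eval[OF nt[OF f] G]
        continuous_map_compose[OF abc(1) CX_continuous[OF X(1) f]]
      by (intro continuous_map_add) (simp_all add: o_def)
    show "G z (ntilde X f) + f (a z) = 0" if "z \<in> topspace Z" "a z = b z" for z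
      using G_val[of z f] that f by simp
  qed
  then obtain H0 where H0: "\<And>f. f \<in> CX X \<Longrightarrow> countable (H0 f) \<and> H0 f \<subseteq> CX X"
    "\<And>f z. f \<in> CX X \<Longrightarrow> z \<in> topspace Z \<Longrightarrow> (\<And>h. h \<in> H0 f \<Longrightarrow> h (a z) = h (b z)) \<Longrightarrow>
       G z (ntilde X f) = - f (a z)"
    by (metis add_eq_0_iff2)
  define mult where "mult f m = (\<lambda>x\<in>topspace X. of_int m * f x)" for f :: "'a \<Rightarrow> real" and m
  have mult: "mult f m \<in> CX X" if "f \<in> CX X" for f m
    unfolding mult_def using CX_continuous[OF X(1) that]
    by (intro restrict_in_CX[OF X(1)] continuous_map_real_mult) auto
  define H where "H f = (\<Union>m. H0 (mult f m))" for f
  \<comment> \<open>A shifted multiple of \<open>f\<close> dominates \<open>h\<close> at \<open>c z\<close> and agrees with it at \<open>y\<close>.\<close>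
  have lower: "- h y \<le> G z (ntilde X h)"
    if \<F>: "\<F> \<subseteq> CX X" "\<And>f. f \<in> \<F> \<Longrightarrow> H f \<subseteq> \<F>" and z: "z \<in> topspace Z" and h: "h \<in> CX X"
      and eq: "\<And>f. f \<in> \<F> \<Longrightarrow> f (a z) = f y" and y: "b z = y"
      and f: "f \<in> \<F>" "f (c z) \<noteq> f y" for \<F> z h y f
  proof -
    have fX: "f \<in> CX X" using \<F> f by blast
    have yX: "y \<in> topspace X" using in_X[OF z] y by simp
    obtain m :: int where m: "h (c z) - h y \<le> of_int m * (f (c z) - f y)"
    proof
      let ?r = "(h (c z) - h y) / (f (c z) - f y)"
      define m where "m = (if f y < f (c z) then \<lceil>?r\<rceil> else \<lfloor>?r\<rfloor>)"
      show "h (c z) - h y \<le> of_int m * (f (c z) - f y)"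
      proof (cases "f y < f (c z)")
        case True
        then have "0 < f (c z) - f y" by simp
        from iffD1[OF pos_divide_le_eq[OF this] le_of_int_ceiling[of ?r]] True show ?thesis
          by (simp add: m_def)
      next
        case False
        then have "f (c z) - f y < 0" using f(2) by simp
        from iffD1[OF neg_le_divide_eq[OF this] of_int_floor_le[of ?r]] False show ?thesis
          by (simp add: m_def)
      qed
    qed
    let ?l = "h y - of_int m * f y"
    let ?g = "odot X ?l (mult f m)"
    have g: "?g \<in> CX X" using CX_closed(2)[OF X(1) mult[OF fX]] .
    have "G z (ntilde X ?g) = - h y"
    proof -
      have "ntilde X ?g = odot (IX X) (- ?l) (ntilde X (mult f m))"
        using mult[OF fX]
        by (auto simp: ntilde_def odot_def[of "IX X"] topspace_IX idempotent_measure_def)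
      then have "G z (ntilde X ?g) = - ?l + G z (ntilde X (mult f m))"
        using G_meas[OF z] nt[OF mult[OF fX]] by (simp add: idempotent_measure_def)
      also have "G z (ntilde X (mult f m)) = - mult f m (a z)"
        using eq \<F>(2)[OF f(1)] y by (intro H0(2) mult fX z) (auto simp: H_def)
      also have "mult f m (a z) = of_int m * f y"
        using eq[OF f(1)] in_X[OF z] by (simp add: mult_def)
      finally show ?thesis by simp
    qed
    moreover have "G z (ntilde X ?g) \<le> G z (ntilde X h)"
      using m yX in_X[OF z] bary[OF z] y
      by (intro ntilde_antimono_on_barycenter[where u = "c z" and y = y,
            OF X(1) G_meas[OF z] _ _ _ g h])
        (auto simp: odot_def mult_def algebra_simps)
    ultimately show ?thesis by simp
  qed
  have interior: "x \<notin> X closure_of {u \<in> topspace X. \<exists>f\<in>\<F>. f u \<noteq> f x}"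
    if \<F>: "\<F> \<subseteq> CX X" "\<And>f. f \<in> \<F> \<Longrightarrow> H f \<subseteq> \<F>" and xy: "x \<in> topspace X" "y \<in> topspace X" "x \<noteq> y"
      and eq: "\<And>f. f \<in> \<F> \<Longrightarrow> f x = f y" for \<F> x y
  proof
    assume cl: "x \<in> X closure_of {u \<in> topspace X. \<exists>f\<in>\<F>. f u \<noteq> f x}"
    obtain h where h: "h \<in> CX X" "h y < h x" using CX_separates_points[OF X xy] .
    \<comment> \<open>\<open>c\<close> maps \<open>S\<close> onto a closed set that contains the complement of the fibre, hence also \<open>x\<close>; over
      \<open>(x, y, x)\<close>, however, the lift takes the value \<open>- max (h x) (h y) < - h y\<close>.\<close>
    define S where "S = {z \<in> topspace Z. a z \<in> {x}} \<inter> {z \<in> topspace Z. b z \<in> {y}} \<inter>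
      {z \<in> topspace Z. G z (ntilde X h) \<in> {- h y..}}"
    have "closedin X {x}" "closedin X {y}"
      using X(2) xy by (simp_all add: closedin_Hausdorff_singleton)
    then have "closedin Z S"
      unfolding S_def
      by (intro closedin_Int closedin_continuous_map_preimage[OF abc(1)]
          closedin_continuous_map_preimage[OF abc(2)]
          closedin_continuous_map_preimage[OF continuous_map_IX_eval[OF nt[OF h(1)] G]]) simp_all
    then have "closedin X (c ` S)"
      using continuous_imp_closed_map[OF abc(3) Z X(2)] by (simp add: closed_map_def)
    moreover have "{u \<in> topspace X. \<exists>f\<in>\<F>. f u \<noteq> f x} \<subseteq> c ` S"
    proof clarify
      fix u f assume u: "u \<in> topspace X" "f \<in> \<F>" "f u \<noteq> f x"
      obtain z where z: "z \<in> topspace Z" "a z = x" "b z = y" "c z = u"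
        using onto[OF xy(1,2) u(1)] by blast
      have "- h y \<le> G z (ntilde X h)"
        using lower[of \<F> z h y f] \<F> z h(1) eq u(2,3) by metis
      then show "u \<in> c ` S" using z by (auto simp: S_def)
    qed
    ultimately have "x \<in> c ` S" using cl closure_of_minimal by blast
    then obtain z where z: "z \<in> topspace Z" "a z = x" "b z = y" "c z = x" "- h y \<le> G z (ntilde X h)"
      by (auto simp: S_def)
    then show False using G_val[of z h] h by simp
  qed
  show thesis
  proof
    show "\<forall>f\<in>CX X. countable (H f) \<and> H f \<subseteq> CX X"
      using H0(1)[OF mult] by (auto simp: H_def)
  next
    show "\<forall>\<F> x y. \<F> \<subseteq> CX X \<and> (\<forall>f\<in>\<F>. H f \<subseteq> \<F>) \<and>
       x \<in> topspace X \<and> y \<in> topspace X \<and> x \<noteq> y \<and> (\<forall>f\<in>\<F>. f x = f y) \<longrightarrow>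
       openin X {u \<in> topspace X. \<forall>f\<in>\<F>. f u = f x}"
    proof (intro allI impI, elim conjE)
      fix \<F> x y
      assume \<F>X: "\<F> \<subseteq> CX X" and closed: "\<forall>f\<in>\<F>. H f \<subseteq> \<F>" and eq: "\<forall>f\<in>\<F>. f x = f y"
        and xy: "x \<in> topspace X" "y \<in> topspace X" "x \<noteq> y"
      note \<F> = \<F>X closed[THEN bspec]
      let ?E = "{u \<in> topspace X. \<forall>f\<in>\<F>. f u = f x}"
      let ?C = "{u \<in> topspace X. \<exists>f\<in>\<F>. f u \<noteq> f x}"
      have "w \<notin> X closure_of ?C" if w: "w \<in> ?E" for w
      proof -
        have C: "?C = {u \<in> topspace X. \<exists>f\<in>\<F>. f u \<noteq> f w}"
          using w by (intro Collect_cong conj_cong bex_cong) auto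
        obtain w' where w': "w' \<in> topspace X" "w \<noteq> w'" "\<And>f. f \<in> \<F> \<Longrightarrow> f w = f w'"
          using xy eq w by (cases "w = x") auto
        have "w \<in> topspace X" using w by simp
        from interior[OF \<F> this w'] show ?thesis unfolding C .
      qed
      moreover have "?C \<subseteq> X closure_of ?C" by (rule closure_of_subset) auto
      ultimately have "?E = topspace X - X closure_of ?C" by blast
      then show "openin X ?E" by (simp add: openin_diff)
    qed
  qed
qed

section \<open>Metrizability\<close>

theorem theorem4p8:
  fixes X :: "'a topology"
  assumes "compact_space X" and "Hausdorff_space X"
    and "zero_soft (IX (IX X)) (IX X) (idem_barycenter X)"
  shows "metrizable_space X"
proof -
  note X = assms(1,2)
  obtain H where H: "\<forall>f\<in>CX X. countable (H f) \<and> H f \<subseteq> CX X"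
    and fibre: "\<forall>\<F> x y. \<F> \<subseteq> CX X \<and> (\<forall>f\<in>\<F>. H f \<subseteq> \<F>) \<and>
       x \<in> topspace X \<and> y \<in> topspace X \<and> x \<noteq> y \<and> (\<forall>f\<in>\<F>. f x = f y) \<longrightarrow>
       openin X {u \<in> topspace X. \<forall>f\<in>\<F>. f u = f x}"
    by (rule open_nontrivial_fibres[OF assms]) (rule that)
  have "\<exists>g. g \<in> CX X \<and>
      (\<forall>x\<in>fun_box X t. \<forall>y\<in>fun_box X t. x \<noteq> y \<longrightarrow> (\<exists>v\<in>fun_box X t. \<exists>w\<in>fun_box X t. g v \<noteq> g w))"
    for t :: "(('a \<Rightarrow> real) \<times> real \<times> real) set"
  proof (cases "\<exists>x\<in>fun_box X t. \<exists>y\<in>fun_box X t. x \<noteq> y")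
    case True
    then obtain x y where xy: "x \<in> fun_box X t" "y \<in> fun_box X t" "x \<noteq> y" by blast
    then obtain g where "g \<in> CX X" "g y < g x"
      using CX_separates_points[OF X, of x y] by (auto simp: fun_box_def)
    then show ?thesis
      using xy(1,2) by (intro exI[of _ g] conjI ballI impI bexI[of _ x] bexI[of _ y]) auto
  next
    case False
    then show ?thesis using CX_closed(1)[OF X(1)] by blast
  qed
  then have "\<forall>t. \<exists>g. g \<in> CX X \<and>
      (\<forall>x\<in>fun_box X t. \<forall>y\<in>fun_box X t. x \<noteq> y \<longrightarrow> (\<exists>v\<in>fun_box X t. \<exists>w\<in>fun_box X t. g v \<noteq> g w))" ..
  from choice[OF this] obtain split where split: "\<And>t. split t \<in> CX X"
    "\<And>t x y. x \<in> fun_box X t \<Longrightarrow> y \<in> fun_box X t \<Longrightarrow> x \<noteq> y \<Longrightarrow>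
       \<exists>v\<in>fun_box X t. \<exists>w\<in>fun_box X t. split t v \<noteq> split t w"
    by blast
  \<comment> \<open>A family that is closed under \<open>T\<close> has only open nontrivial fibres, and it splits each of them.\<close>
  define T where "T s = (\<Union>f\<in>s. H f) \<union> split ` Fpow (s \<times> \<rat> \<times> \<rat>)" for s
  have T: "\<forall>s. finite s \<and> s \<subseteq> CX X \<longrightarrow> countable (T s) \<and> T s \<subseteq> CX X"
  proof (intro allI impI, elim conjE)
    fix s :: "('a \<Rightarrow> real) set"
    assume s: "finite s" "s \<subseteq> CX X"
    have "countable (\<Union>f\<in>s. H f)"
      using H s(2) by (intro countable_UN countable_finite[OF s(1)]) blast
    moreover have "(\<Union>f\<in>s. H f) \<subseteq> CX X"
      using H s(2) by blast
    moreover have "countable (s \<times> \<rat> \<times> (\<rat> :: real set))"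
      using s(1) by (intro countable_SIGMA) (auto simp: countable_finite countable_rat)
    then have "countable (split ` Fpow (s \<times> \<rat> \<times> \<rat>))"
      by (intro countable_image countable_Fpow)
    ultimately show "countable (T s) \<and> T s \<subseteq> CX X"
      using split(1) by (auto simp: T_def)
  qed
  obtain \<F> where \<F>: "countable \<F>" "\<F> \<subseteq> CX X" "\<And>s. finite s \<Longrightarrow> s \<subseteq> \<F> \<Longrightarrow> T s \<subseteq> \<F>"
    by (rule countable_closed_subset[OF T]) (rule that)
  show ?thesis
  proof (rule metrizable_if_countable_separating[OF X(1) \<F>(1,2)], rule ccontr)
    fix x y assume xy: "x \<in> topspace X" "y \<in> topspace X" "x \<noteq> y"
      and eq: "\<And>f. f \<in> \<F> \<Longrightarrow> f x = f y"
    define E where "E = {u \<in> topspace X. \<forall>f\<in>\<F>. f u = f x}"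
    have E_const: "f u = f x" if "f \<in> \<F>" "u \<in> E" for f u
      using that unfolding E_def by blast
    have "H f \<subseteq> \<F>" if "f \<in> \<F>" for f
      using \<F>(3)[of "{f}"] that by (auto simp: T_def)
    then have "\<F> \<subseteq> CX X \<and> (\<forall>f\<in>\<F>. H f \<subseteq> \<F>) \<and>
       x \<in> topspace X \<and> y \<in> topspace X \<and> x \<noteq> y \<and> (\<forall>f\<in>\<F>. f x = f y)"
      using xy eq \<F>(2) by (intro conjI ballI)
    then have E: "openin X E"
      unfolding E_def by (rule fibre[THEN spec, THEN spec, THEN spec, THEN mp])
    obtain t where t: "finite t" "t \<subseteq> \<F> \<times> \<rat> \<times> \<rat>" "fun_box X t = E"
      using open_fibre_is_fun_box[OF X(1) \<F>(2) E[unfolded E_def], folded E_def]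
      by (elim exE conjE) (rule that)
    have split_\<F>: "split t \<in> \<F>"
    proof -
      have "t \<subseteq> fst ` t \<times> \<rat> \<times> \<rat>" using t(2) by force
      then have "split t \<in> T (fst ` t)" using t(1) by (simp add: T_def Fpow_def)
      moreover have "T (fst ` t) \<subseteq> \<F>" using t(1,2) by (intro \<F>(3)) auto
      ultimately show ?thesis by blast
    qed
    have "split t v = split t w" if "v \<in> E" "w \<in> E" for v w
      using E_const[OF split_\<F> that(1)] E_const[OF split_\<F> that(2)] by simp
    moreover have "x \<in> E" unfolding E_def using xy(1) by blast
    moreover have "y \<in> E" unfolding E_def using xy(2) eq[symmetric] by blast
    ultimately show False using split(2)[of x t y, unfolded t(3)] xy(3) by (metis (lifting))
  qed
qed

end
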